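(* Let $G$ be a group and let $\mathcal{D}=\{f:\{0,1\}^*\to G\mid f(w)=f(w0)\cdot f(w1)^{-1}\text{ for all }w\in\{0,1\}^*\}$, with $|f|=f(\epsilon)$ and $(g\bullet f)(w)=g\cdot f(w)\cdot g^{-1}$. Then: (1) $\mathcal{D}$ is a crossed $G$-set, and the map $\varphi:\mathcal{D}\times\mathcal{D}\to\mathcal{D}$ given by $\varphi(f_0,f_1)(\epsilon)=f_0(\epsilon)f_1(\epsilon)^{-1}$, $\varphi(f_0,f_1)(0w)=f_0(w)$, $\varphi(f_0,f_1)(1w)=f_1(w)$ is a bijection inducing an isomorphism $\mathcal{D}\otimes\mathcal{D}^*\cong\mathcal{D}$ in $\mathbf{XRel}(G)$. (2) $\mathcal{D}\cong\mathcal{D}^*$ in $\mathbf{XRel}(G)$ via $f\mapsto f^*=\varphi(\lambda w.f(1w),\lambda w.f(0w))$. (3) $\mathcal{D}$ is a model of the braided lambda calculus validating $\eta$: interpreting a judgement $x_1,\dots,x_n\vdash M$ as the relation $[\![x_1,\dots,x_n\vdash M]\!]\subseteq\mathcal{D}^n\times\mathcal{D}$ given by $[\![x\vdash x]\!]=\{(a,a)\mid a\in\mathcal{D}\}$, $[\![\Gamma\vdash\lambda x.M]\!]=\{(\vec u,\varphi(b,a))\mid((\vec u,a),b)\in[\![\Gamma,x\vdash M]\!]\}$, $[\![\Gamma,\Delta\vdash M\,N]\!]=\{((\vec u,\vec v),b)\mid\exists a,\ (\vec u,\varphi(b,a))\in[\![\Gamma\vdash M]\!]\text{ and }(\vec v,a)\in[\![\Delta\vdash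 N]\!]\}$, $[\![x_{s(1)},\dots,x_{s(n)}\vdash[s]M]\!]=[\![s]\!];[\![x_1,\dots,x_n\vdash M]\!]$, if $\Gamma\vdash M$, $\Gamma\vdash N$ and $M=_{\beta\eta}N$, then $[\![\Gamma\vdash M]\!]=[\![\Gamma\vdash N]\!]$.
   Context: Crossed $G$-sets. A crossed $G$-set is a set $X$ with a $G$-action $\bullet$ and a map $|\_|:X\to G$ with $|g\bullet x|=g|x|g^{-1}$. $\mathbf{XRel}(G)$ is the category with crossed $G$-sets as objects, and as morphisms $X\to Y$ the relations $r\subseteq X\times Y$ such that $(x,y)\in r$ implies $|x|=|y|$ and $(g\bullet x,g\bullet y)\in r$ for all $g\in G$; composition $r;r'$ is relational composition in diagrammatic order. $X\otimes Y$ is $X\times Y$ with $g\bullet(x,y)=(g\bullet x,g\bullet y)$ and $|(x,y)|=|x||y|$. $X^*$ is $X$ with the same action and valuation $x\mapsto|x|^{-1}$. $\{0,1\}^*$ is the set of finite words, $\epsilon$ the empty word. Interpretation of braids. For $s\in B_n$, $[\![s]\!]\subseteq\mathcal{D}^n\times\mathcal{D}^n$ is determined by $[\![ss']\!]=[\![s]\!];[\![s']\!]$, $[\![e]\!]=\mathrm{id}$, and $[\![\sigma_i]\!]$ (resp. $[\![\sigma_i^{-1}]\!]$) acting on coordinates $i,i+1$ by $\{((a,b),(|a|\bullet b,a))\}$ (resp. $\{((a,b),(b,|b|^{-1}\bullet a))\}$) and as the identity elsewhere. Braid groups. $B_n$ is the Artin braid group with generators $\sigma_1,\dots,\sigma_{n-1}$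 and relations $\sigma_i\sigma_j=\sigma_j\sigma_i$ for $|i-j|\ge 2$ and $\sigma_i\sigma_{i+1}\sigma_i=\sigma_{i+1}\sigma_i\sigma_{i+1}$ ($1\le i\le n-2$); $B_0,B_1$ are trivial. The unit of $B_n$ is written $e$ or $\mathrm{id}_n$. Each $s\in B_n$ induces a permutation $i\mapsto s(i)$ of $\{1,\dots,n\}$, where $\sigma_j^{\pm1}$ induces the transposition $(j\ j{+}1)$ and $(ss')(i)=s'(s(i))$. For $s\in B_n$, $s'\in B_m$, the parallel composition $s\otimes s'\in B_{n+m}$ is $s$ on the first $n$ strands and $s'$ on the last $m$ strands (so $\sigma_j$ in $s'$ becomes $\sigma_{n+j}$). Terms. Contexts are finite lists of distinct variables; terms are taken up to renaming of bound variables. Judgements $\Gamma\vdash M$ are derived by: $x\vdash x$; if $\Gamma,x\vdash M$ then $\Gamma\vdash\lambda x.M$; if $\Gamma\vdash M$ and $\Gamma'\vdash N$ (disjoint contexts) then $\Gamma,\Gamma'\vdash M\,N$; if $x_1,\dots,x_n\vdash M$ and $s\in B_n$ then $x_{s(1)},\dots,x_{s(n)}\vdash[s]M$. Substitution on braids. For $1\le i\le n$, $m\ge0$, the map $(-)[i:=m]:B_n\to B_{n+m-1}$ (replacing the strand starting at position $i$ by $m$ parallel strands) is defined by $e[i:=m]=e$; $(\sigma_js)[i:=m]=\sigma_{j+m-1}(s[i:=m])$ if $i\le j-1$; $(\sigma_js)[i:=m]=\sigma_j(s[i:=m])$ if $i\ge j+2$; $(\sigma_js)[j:=m]=\sigma_{j+m-1}\cdots\sigma_{j+1}\sigma_j(s[j{+}1:=m])$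 for $m\geq1$ and $=s[j{+}1:=0]$ for $m=0$; $(\sigma_js)[j{+}1:=m]=\sigma_j\sigma_{j+1}\cdots\sigma_{j+m-1}(s[j:=m])$ for $m\ge1$ and $=s[j:=0]$ for $m=0$; and the same clauses for $\sigma_j^{-1}s$ with every displayed generator replaced by its inverse (in the same order). Substitution on terms. $M[x:=N]$ is the usual capture-avoiding replacement of the unique free occurrence of $x$ on variables, abstractions and applications, and, if $x_1,\dots,x_n\vdash M$, $s\in B_n$ and $N$ has $m$ free variables, $([s]M)[x_i:=N]=\big[s[s^{-1}(i):=m]\big](M[x_i:=N])$. Equality. $=_{\beta\eta}$ is the smallest congruence on terms (braids being elements of $B_n$) containing $(\lambda x.M)N=M[x:=N]$; $\lambda x.M\,x=M$; $[\mathrm{id}_n]M=M$; $[s]([s']M)=[ss']M$; $([s]M)([s']N)=[s\otimes s'](M\,N)$; $[s](\lambda x.M)=\lambda x.[s\otimes\mathrm{id}_1]M$. *)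

theory Defs
  imports "HOL-Algebra.Group_Action" "HOL-Combinatorics.Transposition"
begin

section \<open>Crossed G-sets and the category XRel(G)\<close>

record ('g, 'x) xset =
  points :: "'x set"
  act :: "'g \<Rightarrow> 'x \<Rightarrow> 'x"
  val :: "'x \<Rightarrow> 'g"

(* The restriction is needed because BijGroup consists of extensional functions;
   the values of act outside carrier and points are irrelevant. *)
definition crossed_gset :: "('g, 'm) monoid_scheme \<Rightarrow> ('g, 'x) xset \<Rightarrow> bool" where
  "crossed_gset G X \<longleftrightarrow>
     group_action G (points X) (\<lambda>g. restrict (act X g) (points X)) \<and>
     val X \<in> points X \<rightarrow> carrier G \<and>
     (\<forall>g\<in>carrier G. \<forall>x\<in>points X. val X (act X g x) = g \<otimes>\<^bsub>G\<^esub> val X x \<otimes>\<^bsub>G\<^esub> inv\<^bsub>G\<^esub> g)"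

definition xrel_hom ::
  "('g, 'm) monoid_scheme \<Rightarrow> ('g, 'x) xset \<Rightarrow> ('g, 'y) xset \<Rightarrow> ('x \<times> 'y) set set" where
  "xrel_hom G X Y =
     {r. r \<subseteq> points X \<times> points Y \<and>
         (\<forall>(x, y)\<in>r. val X x = val Y y \<and> (\<forall>g\<in>carrier G. (act X g x, act Y g y) \<in> r))}"

(* O is relational composition in diagrammatic order. *)
definition xrel_iso ::
  "('g, 'm) monoid_scheme \<Rightarrow> ('g, 'x) xset \<Rightarrow> ('g, 'y) xset \<Rightarrow> ('x \<times> 'y) set \<Rightarrow> bool" where
  "xrel_iso G X Y r \<longleftrightarrow>
     crossed_gset G X \<and> crossed_gset G Y \<and> r \<in> xrel_hom G X Y \<and>
     (\<exists>r'\<in>xrel_hom G Y X. r O r' = Id_on (points X) \<and> r' O r = Id_on (points Y))"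

definition xtensor ::
  "('g, 'm) monoid_scheme \<Rightarrow> ('g, 'x) xset \<Rightarrow> ('g, 'y) xset \<Rightarrow> ('g, 'x \<times> 'y) xset" where
  "xtensor G X Y =
     \<lparr>points = points X \<times> points Y,
      act = (\<lambda>g (x, y). (act X g x, act Y g y)),
      val = (\<lambda>(x, y). val X x \<otimes>\<^bsub>G\<^esub> val Y y)\<rparr>"

definition xdual :: "('g, 'm) monoid_scheme \<Rightarrow> ('g, 'x) xset \<Rightarrow> ('g, 'x) xset" where
  "xdual G X = \<lparr>points = points X, act = act X, val = (\<lambda>x. inv\<^bsub>G\<^esub> (val X x))\<rparr>"


section \<open>The crossed G-set D\<close>

(* In words over bool, False stands for 0 and True for 1. *)
definition tree_set :: "('g, 'm) monoid_scheme \<Rightarrow> (bool list \<Rightarrow> 'g) set" where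
  "tree_set G = {f. (\<forall>w. f w \<in> carrier G) \<and>
                    (\<forall>w. f w = f (w @ [False]) \<otimes>\<^bsub>G\<^esub> inv\<^bsub>G\<^esub> (f (w @ [True])))}"

definition tree_xset :: "('g, 'm) monoid_scheme \<Rightarrow> ('g, bool list \<Rightarrow> 'g) xset" where
  "tree_xset G =
     \<lparr>points = tree_set G,
      act = (\<lambda>g f w. g \<otimes>\<^bsub>G\<^esub> f w \<otimes>\<^bsub>G\<^esub> inv\<^bsub>G\<^esub> g),
      val = (\<lambda>f. f [])\<rparr>"

definition tree_phi ::
  "('g, 'm) monoid_scheme \<Rightarrow> (bool list \<Rightarrow> 'g) \<Rightarrow> (bool list \<Rightarrow> 'g) \<Rightarrow> bool list \<Rightarrow> 'g" where
  "tree_phi G f0 f1 =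
     (\<lambda>w. case w of [] \<Rightarrow> f0 [] \<otimes>\<^bsub>G\<^esub> inv\<^bsub>G\<^esub> (f1 [])
                  | b # v \<Rightarrow> if b then f1 v else f0 v)"

definition tree_star :: "('g, 'm) monoid_scheme \<Rightarrow> (bool list \<Rightarrow> 'g) \<Rightarrow> bool list \<Rightarrow> 'g" where
  "tree_star G f = tree_phi G (\<lambda>w. f (True # w)) (\<lambda>w. f (False # w))"


section \<open>Braid groups\<close>

(* (j, True) stands for the generator sigma_j, (j, False) for its inverse. *)
type_synonym bword = "(nat \<times> bool) list"

definition bwords :: "nat \<Rightarrow> bword set" where
  "bwords n = lists ({1..<n} \<times> UNIV)"

inductive braid_eq :: "nat \<Rightarrow> bword \<Rightarrow> bword \<Rightarrow> bool" for n where
  refl: "w \<in> bwords n \<Longrightarrow> braid_eq n w w"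
| sym: "braid_eq n v w \<Longrightarrow> braid_eq n w v"
| trans: "braid_eq n u v \<Longrightarrow> braid_eq n v w \<Longrightarrow> braid_eq n u w"
| append: "braid_eq n u u' \<Longrightarrow> braid_eq n v v' \<Longrightarrow> braid_eq n (u @ v) (u' @ v')"
| cancel: "j \<in> {1..<n} \<Longrightarrow> braid_eq n [(j, e), (j, \<not> e)] []"
| far: "i \<in> {1..<n} \<Longrightarrow> j \<in> {1..<n} \<Longrightarrow> i + 2 \<le> j \<Longrightarrow>
          braid_eq n [(i, True), (j, True)] [(j, True), (i, True)]"
| yang_baxter: "i \<in> {1..<n} \<Longrightarrow> i + 1 \<in> {1..<n} \<Longrightarrow>
          braid_eq n [(i, True), (i + 1, True), (i, True)]
                     [(i + 1, True), (i, True), (i + 1, True)]"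

type_synonym braid = "bword set"

definition braid_class :: "nat \<Rightarrow> bword \<Rightarrow> braid" where
  "braid_class n w = {(v, w). braid_eq n v w} `` {w}"

definition braid_group :: "nat \<Rightarrow> braid monoid" where
  "braid_group n =
     \<lparr>carrier = bwords n // {(v, w). braid_eq n v w},
      mult = (\<lambda>s t. \<Union>u\<in>s. \<Union>v\<in>t. braid_class n (u @ v)),
      one = braid_class n []\<rparr>"

fun word_perm :: "bword \<Rightarrow> nat \<Rightarrow> nat" where
  "word_perm [] i = i"
| "word_perm ((j, e) # w) i = word_perm w (Transposition.transpose j (j + 1) i)"

definition braid_perm :: "braid \<Rightarrow> nat \<Rightarrow> nat" where
  "braid_perm s = the_elem (word_perm ` s)"

definition braid_tensor :: "nat \<Rightarrow> nat \<Rightarrow> braid \<Rightarrow> braid \<Rightarrow> braid" where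
  "braid_tensor n m s t =
     (\<Union>u\<in>s. \<Union>v\<in>t. braid_class (n + m) (u @ map (\<lambda>(j, e). (n + j, e)) v))"

(* In the two middle clauses the list of crossings is empty for m = 0. *)
fun word_subst :: "bword \<Rightarrow> nat \<Rightarrow> nat \<Rightarrow> bword" where
  "word_subst [] i m = []"
| "word_subst ((j, e) # w) i m =
     (if i < j then (j + m - 1, e) # word_subst w i m
      else if i = j then map (\<lambda>k. (k, e)) (rev [j..<j + m]) @ word_subst w (j + 1) m
      else if i = j + 1 then map (\<lambda>k. (k, e)) [j..<j + m] @ word_subst w j m
      else (j, e) # word_subst w i m)"

definition braid_subst :: "nat \<Rightarrow> braid \<Rightarrow> nat \<Rightarrow> nat \<Rightarrow> braid" where
  "braid_subst n s i m = (\<Union>w\<in>s. braid_class (n + m - 1) (word_subst w i m))"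


section \<open>Interpretation of braids\<close>

definition xpower :: "('g, 'x) xset \<Rightarrow> nat \<Rightarrow> 'x list set" where
  "xpower X n = {u. length u = n \<and> set u \<subseteq> points X}"

definition crossing ::
  "('g, 'm) monoid_scheme \<Rightarrow> ('g, 'x) xset \<Rightarrow> bool \<Rightarrow> (('x \<times> 'x) \<times> ('x \<times> 'x)) set" where
  "crossing G X e =
     (if e then {((a, b), (act X (val X a) b, a)) | a b. True}
      else {((a, b), (b, act X (inv\<^bsub>G\<^esub> (val X b)) a)) | a b. True})"

(* Strand positions start at 1, list positions at 0. *)
definition gen_rel ::
  "('g, 'm) monoid_scheme \<Rightarrow> ('g, 'x) xset \<Rightarrow> nat \<Rightarrow> nat \<times> bool \<Rightarrow> ('x list \<times> 'x list) set" where
  "gen_rel G X n = (\<lambda>(j, e).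
     {(u, v). u \<in> xpower X n \<and> v \<in> xpower X n \<and>
        ((u ! (j - 1), u ! j), (v ! (j - 1), v ! j)) \<in> crossing G X e \<and>
        (\<forall>k<n. k \<noteq> j - 1 \<and> k \<noteq> j \<longrightarrow> v ! k = u ! k)})"

fun word_rel ::
  "('g, 'm) monoid_scheme \<Rightarrow> ('g, 'x) xset \<Rightarrow> nat \<Rightarrow> bword \<Rightarrow> ('x list \<times> 'x list) set" where
  "word_rel G X n [] = Id_on (xpower X n)"
| "word_rel G X n (g # w) = gen_rel G X n g O word_rel G X n w"

definition braid_rel ::
  "('g, 'm) monoid_scheme \<Rightarrow> ('g, 'x) xset \<Rightarrow> nat \<Rightarrow> braid \<Rightarrow> ('x list \<times> 'x list) set" where
  "braid_rel G X n s = (\<Union>w\<in>s. word_rel G X n w)"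


section \<open>Terms\<close>

(* Locally nameless representation: free variables are named, bound variables are
   de Bruijn indices, so terms equal up to renaming of bound variables coincide. *)
type_synonym var = string

datatype atom = Free var | Bound nat

datatype trm = Atom atom | App trm trm | Lam trm | Braid braid trm

abbreviation Var :: "var \<Rightarrow> trm" where
  "Var x \<equiv> Atom (Free x)"

fun bind_var :: "nat \<Rightarrow> var \<Rightarrow> trm \<Rightarrow> trm" where
  "bind_var k x (Atom a) = Atom (if a = Free x then Bound k else a)"
| "bind_var k x (App M N) = App (bind_var k x M) (bind_var k x N)"
| "bind_var k x (Lam M) = Lam (bind_var (Suc k) x M)"
| "bind_var k x (Braid s M) = Braid s (bind_var k x M)"

(* The abstraction of the named variable x in M. *)
definition lam :: "var \<Rightarrow> trm \<Rightarrow> trm" where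
  "lam x M = Lam (bind_var 0 x M)"

(* The list whose i-th entry is the s(i)-th entry of xs. *)
definition braid_permute :: "braid \<Rightarrow> 'a list \<Rightarrow> 'a list" where
  "braid_permute s xs = map (\<lambda>i. xs ! (braid_perm s i - 1)) [1..<length xs + 1]"

inductive judgement :: "var list \<Rightarrow> trm \<Rightarrow> bool" (infix "\<turnstile>" 50) where
  var: "[x] \<turnstile> Var x"
| lam: "\<Gamma> @ [x] \<turnstile> M \<Longrightarrow> \<Gamma> \<turnstile> lam x M"
| app: "\<Gamma> \<turnstile> M \<Longrightarrow> \<Delta> \<turnstile> N \<Longrightarrow> set \<Gamma> \<inter> set \<Delta> = {} \<Longrightarrow> \<Gamma> @ \<Delta> \<turnstile> App M N"
| braid: "\<Gamma> \<turnstile> M \<Longrightarrow> s \<in> carrier (braid_group (length \<Gamma>)) \<Longrightarrow>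
            braid_permute s \<Gamma> \<turnstile> Braid s M"

(* The context of a term, read off from the term; below a binder it also contains
   the bound variables in scope. See judgement_context for terms in a judgement. *)
fun context_of :: "trm \<Rightarrow> atom list" where
  "context_of (Atom a) = [a]"
| "context_of (App M N) = context_of M @ context_of N"
| "context_of (Lam M) =
     map (\<lambda>a. case a of Free x \<Rightarrow> Free x | Bound k \<Rightarrow> Bound (k - 1))
       (filter (\<lambda>a. a \<noteq> Bound 0) (context_of M))"
| "context_of (Braid s M) = braid_permute s (context_of M)"

(* M[x := N]. No free variable of N can be captured, since bound variables are nameless.
   In the last clause n is the number of variables of M, and i the position of x among them. *)
fun subst :: "trm \<Rightarrow> var \<Rightarrow> trm \<Rightarrow> trm" where
  "subst (Atom a) x N = (if a = Free x then N else Atom a)"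
| "subst (App M M') x N = App (subst M x N) (subst M' x N)"
| "subst (Lam M) x N = Lam (subst M x N)"
| "subst (Braid s M) x N =
     (if Free x \<in> set (context_of M) then
        let n = length (context_of M);
            i = length (takeWhile (\<lambda>a. a \<noteq> Free x) (context_of M)) + 1;
            m = length (context_of N)
        in Braid (braid_subst n s (inv_into {1..n} (braid_perm s) i) m) (subst M x N)
      else Braid s M)"

(* The premises make sure that only terms, i.e. those M with a judgement, are related. *)
inductive beta_eta :: "trm \<Rightarrow> trm \<Rightarrow> bool" (infix "=\<^sub>\<beta>\<^sub>\<eta>" 50) where
  refl: "\<Gamma> \<turnstile> M \<Longrightarrow> M =\<^sub>\<beta>\<^sub>\<eta> M"
| sym: "M =\<^sub>\<beta>\<^sub>\<eta> N \<Longrightarrow> N =\<^sub>\<beta>\<^sub>\<eta> M"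
| trans: "M =\<^sub>\<beta>\<^sub>\<eta> N \<Longrightarrow> N =\<^sub>\<beta>\<^sub>\<eta> P \<Longrightarrow> M =\<^sub>\<beta>\<^sub>\<eta> P"
| cong_lam: "M =\<^sub>\<beta>\<^sub>\<eta> N \<Longrightarrow> \<Gamma> @ [x] \<turnstile> M \<Longrightarrow> \<Gamma> @ [x] \<turnstile> N \<Longrightarrow> lam x M =\<^sub>\<beta>\<^sub>\<eta> lam x N"
| cong_app: "M =\<^sub>\<beta>\<^sub>\<eta> M' \<Longrightarrow> N =\<^sub>\<beta>\<^sub>\<eta> N' \<Longrightarrow> \<Gamma> \<turnstile> App M N \<Longrightarrow> \<Gamma> \<turnstile> App M' N' \<Longrightarrow>
               App M N =\<^sub>\<beta>\<^sub>\<eta> App M' N'"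
| cong_braid: "M =\<^sub>\<beta>\<^sub>\<eta> N \<Longrightarrow> \<Gamma> \<turnstile> Braid s M \<Longrightarrow> \<Gamma> \<turnstile> Braid s N \<Longrightarrow> Braid s M =\<^sub>\<beta>\<^sub>\<eta> Braid s N"
| beta: "\<Gamma> @ [x] \<turnstile> M \<Longrightarrow> \<Delta> \<turnstile> N \<Longrightarrow> set \<Gamma> \<inter> set \<Delta> = {} \<Longrightarrow>
           App (lam x M) N =\<^sub>\<beta>\<^sub>\<eta> subst M x N"
| eta: "\<Gamma> \<turnstile> M \<Longrightarrow> x \<notin> set \<Gamma> \<Longrightarrow> lam x (App M (Var x)) =\<^sub>\<beta>\<^sub>\<eta> M"
| braid_one: "\<Gamma> \<turnstile> M \<Longrightarrow> Braid \<one>\<^bsub>braid_group (length \<Gamma>)\<^esub> M =\<^sub>\<beta>\<^sub>\<eta> M"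
| braid_mult: "\<Gamma> \<turnstile> M \<Longrightarrow> s \<in> carrier (braid_group (length \<Gamma>)) \<Longrightarrow>
           s' \<in> carrier (braid_group (length \<Gamma>)) \<Longrightarrow>
           Braid s (Braid s' M) =\<^sub>\<beta>\<^sub>\<eta> Braid (s \<otimes>\<^bsub>braid_group (length \<Gamma>)\<^esub> s') M"
| braid_app: "\<Gamma> \<turnstile> M \<Longrightarrow> \<Delta> \<turnstile> N \<Longrightarrow> set \<Gamma> \<inter> set \<Delta> = {} \<Longrightarrow>
           s \<in> carrier (braid_group (length \<Gamma>)) \<Longrightarrow>
           s' \<in> carrier (braid_group (length \<Delta>)) \<Longrightarrow>
           App (Braid s M) (Braid s' N) =\<^sub>\<beta>\<^sub>\<eta>
             Braid (braid_tensor (length \<Gamma>) (length \<Delta>) s s') (App M N)"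
| braid_lam: "\<Gamma> @ [x] \<turnstile> M \<Longrightarrow> s \<in> carrier (braid_group (length \<Gamma>)) \<Longrightarrow>
           Braid s (lam x M) =\<^sub>\<beta>\<^sub>\<eta>
             lam x (Braid (braid_tensor (length \<Gamma>) 1 s \<one>\<^bsub>braid_group 1\<^esub>) M)"


section \<open>Interpretation of terms\<close>

inductive denotes ::
  "('g, 'm) monoid_scheme \<Rightarrow> var list \<Rightarrow> trm \<Rightarrow>
   ((bool list \<Rightarrow> 'g) list \<times> (bool list \<Rightarrow> 'g)) set \<Rightarrow> bool" for G where
  var: "denotes G [x] (Var x) {([a], a) | a. a \<in> tree_set G}"
| lam: "denotes G (\<Gamma> @ [x]) M R \<Longrightarrow>
          denotes G \<Gamma> (lam x M) {(u, tree_phi G b a) | u a b. (u @ [a], b) \<in> R}"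
| app: "denotes G \<Gamma> M R \<Longrightarrow> denotes G \<Delta> N S \<Longrightarrow> set \<Gamma> \<inter> set \<Delta> = {} \<Longrightarrow>
          denotes G (\<Gamma> @ \<Delta>) (App M N)
            {(u @ v, b) | u v b. \<exists>a. (u, tree_phi G b a) \<in> R \<and> (v, a) \<in> S}"
| braid: "denotes G \<Gamma> M R \<Longrightarrow> s \<in> carrier (braid_group (length \<Gamma>)) \<Longrightarrow>
          denotes G (braid_permute s \<Gamma>) (Braid s M)
            (braid_rel G (tree_xset G) (length \<Gamma>) s O R)"

definition interp ::
  "('g, 'm) monoid_scheme \<Rightarrow> var list \<Rightarrow> trm \<Rightarrow>
   ((bool list \<Rightarrow> 'g) list \<times> (bool list \<Rightarrow> 'g)) set" where
  "interp G \<Gamma> M = (THE R. denotes G \<Gamma> M R)"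


section \<open>Well-definedness of the operations on braids\<close>

lemma bwords_simps [simp]:
  "[] \<in> bwords n" "g # w \<in> bwords n \<longleftrightarrow> fst g \<in> {1..<n} \<and> w \<in> bwords n"
  "u @ v \<in> bwords n \<longleftrightarrow> u \<in> bwords n \<and> v \<in> bwords n"
  by (cases g; auto simp: bwords_def)+

lemma braid_eq_bwords: "braid_eq n u v \<Longrightarrow> u \<in> bwords n \<and> v \<in> bwords n"
  by (induction rule: braid_eq.induct) auto

lemma equiv_braid_eq: "equiv (bwords n) {(v, w). braid_eq n v w}"
proof (rule equivI)
  show "{(v, w). braid_eq n v w} \<subseteq> bwords n \<times> bwords n" using braid_eq_bwords by blast
  show "refl_on (bwords n) {(v, w). braid_eq n v w}"
    by (auto simp: refl_on_def intro: braid_eq.refl)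
  show "sym {(v, w). braid_eq n v w}" by (auto simp: sym_def intro: braid_eq.sym)
  show "trans {(v, w). braid_eq n v w}" by (auto simp: trans_def intro: braid_eq.trans)
qed

lemma mem_braid_class: "v \<in> braid_class n w \<longleftrightarrow> braid_eq n w v"
  by (simp add: braid_class_def)

lemma braid_class_eq: "braid_eq n v w \<Longrightarrow> braid_class n v = braid_class n w"
  unfolding braid_class_def using equiv_class_eq[OF equiv_braid_eq] by fastforce

lemma braid_class_self: "w \<in> bwords n \<Longrightarrow> w \<in> braid_class n w"
  by (simp add: mem_braid_class braid_eq.refl)

lemma braid_group_carrier: "carrier (braid_group n) = braid_class n ` bwords n"
  by (auto simp: braid_group_def quotient_def braid_class_def)

lemma braid_group_one: "\<one>\<^bsub>braid_group n\<^esub> = braid_class n []"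
  by (simp add: braid_group_def)

lemma braid_group_mult:
  assumes "u \<in> bwords n" "v \<in> bwords n"
  shows "braid_class n u \<otimes>\<^bsub>braid_group n\<^esub> braid_class n v = braid_class n (u @ v)"
proof -
  have "braid_class n (u' @ v') = braid_class n (u @ v)"
    if "u' \<in> braid_class n u" "v' \<in> braid_class n v" for u' v'
    using that by (meson braid_class_eq braid_eq.append braid_eq.sym mem_braid_class)
  then show ?thesis
    using assms by (auto simp: braid_group_def intro: braid_class_self)
qed

definition word_inv :: "bword \<Rightarrow> bword" where
  "word_inv w = rev (map (\<lambda>(j, e). (j, \<not> e)) w)"

lemma word_inv_bwords: "w \<in> bwords n \<Longrightarrow> word_inv w \<in> bwords n"
  by (induction w) (auto simp: word_inv_def)

lemma word_inv_left: "w \<in> bwords n \<Longrightarrow> braid_eq n (word_inv w @ w) []"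
proof (induction w)
  case Nil then show ?case by (auto simp: word_inv_def intro: braid_eq.refl)
next
  case (Cons g w)
  obtain j e where g: "g = (j, e)" by force
  have w: "w \<in> bwords n" "j \<in> {1..<n}" using Cons g by auto
  have "braid_eq n ([(j, \<not> e), (j, e)] @ w) ([] @ w)"
    using w braid_eq.cancel[of j n "\<not> e"] by (intro braid_eq.append braid_eq.refl) auto
  then have "braid_eq n (word_inv w @ ([(j, \<not> e), (j, e)] @ w)) (word_inv w @ w)"
    using w by (intro braid_eq.append braid_eq.refl word_inv_bwords) auto
  then show ?case using Cons.IH[OF w(1)] g
    by (auto simp: word_inv_def intro: braid_eq.trans)
qed

lemma group_braid_group: "group (braid_group n)"
proof (rule groupI)
  fix x y z
  assume "x \<in> carrier (braid_group n)" "y \<in> carrier (braid_group n)" "z \<in> carrier (braid_group n)"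
  then show "x \<otimes>\<^bsub>braid_group n\<^esub> y \<otimes>\<^bsub>braid_group n\<^esub> z = x \<otimes>\<^bsub>braid_group n\<^esub> (y \<otimes>\<^bsub>braid_group n\<^esub> z)"
    by (auto simp: braid_group_carrier braid_group_mult)
next
  fix x assume "x \<in> carrier (braid_group n)"
  then obtain w where w: "w \<in> bwords n" "x = braid_class n w" by (auto simp: braid_group_carrier)
  then have "braid_class n (word_inv w) \<otimes>\<^bsub>braid_group n\<^esub> x = \<one>\<^bsub>braid_group n\<^esub>"
    using braid_class_eq[OF word_inv_left] by (simp add: braid_group_mult word_inv_bwords braid_group_one)
  then show "\<exists>y\<in>carrier (braid_group n). y \<otimes>\<^bsub>braid_group n\<^esub> x = \<one>\<^bsub>braid_group n\<^esub>"
    using w by (auto simp: braid_group_carrier word_inv_bwords)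
qed (auto simp: braid_group_carrier braid_group_mult braid_group_one)

lemma word_perm_append: "word_perm (u @ v) i = word_perm v (word_perm u i)"
  by (induction u arbitrary: i) auto

lemma word_perm_cong: "braid_eq n u v \<Longrightarrow> word_perm u = word_perm v"
proof (induction rule: braid_eq.induct)
  case (append u u' v v')
  then show ?case by (intro ext) (simp add: word_perm_append)
next
  case (cancel j e)
  show ?case by (rule ext) simp
next
  case (far i j)
  show ?case
  proof
    fix k
    consider "k = i" | "k = i + 1" | "k = j" | "k = j + 1"
      | "k \<noteq> i" "k \<noteq> i + 1" "k \<noteq> j" "k \<noteq> j + 1" by blast
    then show "word_perm [(i, True), (j, True)] k = word_perm [(j, True), (i, True)] k"
      using far by cases (simp_all add: Transposition.transpose_def)
  qed
next
  case (yang_baxter i)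
  show ?case
  proof
    fix k
    consider "k = i" | "k = i + 1" | "k = i + 2" | "k \<noteq> i" "k \<noteq> i + 1" "k \<noteq> i + 2" by blast
    then show "word_perm [(i, True), (i + 1, True), (i, True)] k =
               word_perm [(i + 1, True), (i, True), (i + 1, True)] k"
      by cases (simp_all add: Transposition.transpose_def)
  qed
next
  case (sym v w) from sym.IH show ?case by (rule HOL.sym)
next
  case (trans u v w) from trans.IH show ?case by (rule HOL.trans)
qed (rule HOL.refl)

lemma braid_perm_class: "w \<in> bwords n \<Longrightarrow> braid_perm (braid_class n w) = word_perm w"
proof -
  assume "w \<in> bwords n"
  then have "w \<in> braid_class n w" by (rule braid_class_self)
  moreover have "word_perm v = word_perm w" if "v \<in> braid_class n w" for v
    using that word_perm_cong[of n w v] unfolding mem_braid_class by (metis (no_types))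
  ultimately have "word_perm ` braid_class n w = {word_perm w}" by (intro equalityI subsetI; blast)
  then show ?thesis by (simp add: braid_perm_def)
qed

lemma bij_word_perm: "w \<in> bwords n \<Longrightarrow> bij_betw (word_perm w) {1..n} {1..n}"
proof (induction w)
  case Nil then show ?case by (simp add: bij_betw_def inj_on_def)
next
  case (Cons g w)
  obtain j e where g: "g = (j, e)" by force
  have "bij_betw (Transposition.transpose j (j + 1)) {1..n} {1..n}"
    using Cons.prems g by (intro bij_betw_transpose_iff) auto
  from bij_betw_trans[OF this Cons.IH] Cons.prems g
  show ?case by (simp add: o_def fun_eq_iff)
qed

definition word_shift :: "nat \<Rightarrow> bword \<Rightarrow> bword" where
  "word_shift n = map (\<lambda>(j, e). (n + j, e))"

lemma word_shift_cong: "braid_eq m u v \<Longrightarrow> braid_eq (n + m) (word_shift n u) (word_shift n v)"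
proof (induction rule: braid_eq.induct)
  case (refl w)
  then have "word_shift n w \<in> bwords (n + m)" by (induction w) (auto simp: word_shift_def)
  then show ?case by (rule braid_eq.refl)
next
  case (cancel j e) then show ?case by (auto simp: word_shift_def intro!: braid_eq.cancel)
next
  case (far i j) then show ?case by (auto simp: word_shift_def intro!: braid_eq.far)
next
  case (yang_baxter i) then show ?case
    using braid_eq.yang_baxter[of "n + i" "n + m"] by (auto simp: word_shift_def)
qed (auto simp: word_shift_def intro: braid_eq.intros)

lemma braid_eq_mono: "braid_eq n u v \<Longrightarrow> n \<le> m \<Longrightarrow> braid_eq m u v"
proof (induction rule: braid_eq.induct)
  case (refl w)
  then have "w \<in> bwords m" by (induction w) (auto)
  then show ?case by (rule braid_eq.refl)
next
  case (yang_baxter i) then show ?case by (intro braid_eq.yang_baxter) auto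
next
  case (cancel j e) then show ?case by (auto intro!: braid_eq.cancel)
next
  case (far i j) then show ?case by (auto intro!: braid_eq.far)
qed (auto intro: braid_eq.intros)

lemma braid_tensor_class:
  assumes "u \<in> bwords n" "v \<in> bwords m"
  shows "braid_tensor n m (braid_class n u) (braid_class m v) =
           braid_class (n + m) (u @ map (\<lambda>(j, e). (n + j, e)) v)"
proof -
  have "braid_class (n + m) (u' @ word_shift n v') = braid_class (n + m) (u @ word_shift n v)"
    if "u' \<in> braid_class n u" "v' \<in> braid_class m v" for u' v'
  proof (rule braid_class_eq[OF braid_eq.sym], rule braid_eq.append)
    show "braid_eq (n + m) u u'" using that braid_eq_mono by (auto simp: mem_braid_class)
    show "braid_eq (n + m) (word_shift n v) (word_shift n v')"
      using that word_shift_cong by (auto simp: mem_braid_class)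
  qed
  then show ?thesis
    using assms by (auto simp: braid_tensor_def word_shift_def intro: braid_class_self)
qed

lemma word_inv_right: "w \<in> bwords n \<Longrightarrow> braid_eq n (w @ word_inv w) []"
proof -
  assume w: "w \<in> bwords n"
  have "word_inv (word_inv w) = w" by (induction w) (auto simp: word_inv_def)
  with word_inv_left[OF word_inv_bwords[OF w]] show ?thesis by simp
qed

lemma braid_eq_context:
  "braid_eq n u v \<Longrightarrow> a \<in> bwords n \<Longrightarrow> b \<in> bwords n \<Longrightarrow> braid_eq n (a @ u @ b) (a @ v @ b)"
  by (intro braid_eq.append braid_eq.refl)

definition cable_up :: "bool \<Rightarrow> nat \<Rightarrow> nat \<Rightarrow> bword" where
  "cable_up e j m = map (\<lambda>k. (k, e)) [j..<j + m]"

definition cable_down :: "bool \<Rightarrow> nat \<Rightarrow> nat \<Rightarrow> bword" where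
  "cable_down e j m = map (\<lambda>k. (k, e)) (rev [j..<j + m])"

lemma cable_simps:
  "cable_up e j 0 = []" "cable_down e j 0 = []"
  "cable_up e j (Suc m) = cable_up e j m @ [(j + m, e)]"
  "cable_down e j (Suc m) = (j + m, e) # cable_down e j m"
  by (auto simp: cable_up_def cable_down_def)

lemma cable_up_Cons: "cable_up e j (Suc m) = (j, e) # cable_up e (Suc j) m"
  by (auto simp: cable_up_def upt_conv_Cons simp del: upt_Suc)

lemma cable_bwords:
  "j \<ge> 1 \<Longrightarrow> j + m \<le> n \<Longrightarrow> cable_up e j m \<in> bwords n"
  "j \<ge> 1 \<Longrightarrow> j + m \<le> n \<Longrightarrow> cable_down e j m \<in> bwords n"
  by (auto simp: cable_up_def cable_down_def bwords_def)

lemma cable_inv: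
  "word_inv (cable_up e j m) = cable_down (\<not> e) j m"
  "word_inv (cable_down e j m) = cable_up (\<not> e) j m"
  by (auto simp: cable_up_def cable_down_def word_inv_def rev_map)

lemma commute1:
  assumes "v \<in> bwords n" "i \<in> {1..<n}" "\<forall>(j, e)\<in>set v. e \<and> (i + 2 \<le> j \<or> j + 2 \<le> i)"
  shows "braid_eq n ((i, True) # v) (v @ [(i, True)])"
  using assms
proof (induction v)
  case Nil then show ?case by (auto intro: braid_eq.refl)
next
  case (Cons g v)
  then obtain j where g: "g = (j, True)" "j \<in> {1..<n}" "i + 2 \<le> j \<or> j + 2 \<le> i" by (cases g) auto
  have "braid_eq n [(i, True), (j, True)] [(j, True), (i, True)]"
    using g Cons.prems braid_eq.far[of i n j] braid_eq.far[of j n i] braid_eq.sym by auto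
  from braid_eq_context[OF this, of "[]" v] Cons.prems
  have "braid_eq n ((i, True) # g # v) (g # (i, True) # v)" using g by auto
  moreover
  have "braid_eq n ([g] @ ((i, True) # v)) ([g] @ (v @ [(i, True)]))"
    using Cons by (intro braid_eq.append braid_eq.refl) auto
  then have "braid_eq n (g # (i, True) # v) ((g # v) @ [(i, True)])" by simp
  ultimately show ?case by (rule braid_eq.trans)
qed

declare braid_eq.trans [trans]

lemma yang_baxter_down:
  assumes "i \<ge> 1" "i + m < n"
  shows "braid_eq n (cable_down True i m @ cable_down True (i + 1) m @ [(i, True)])
                    ([(i + m, True)] @ cable_down True i m @ cable_down True (i + 1) m)"
  using assms
proof (induction m)
  case 0 then show ?case by (auto simp: cable_simps intro!: braid_eq.refl)
next
  case (Suc m)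
  let ?D = "cable_down True i m" and ?E = "cable_down True (i + 1) m"
  let ?s = "(i + m, True)" and ?t = "(i + m + 1, True)"
  have D: "?D \<in> bwords n" "?E \<in> bwords n" using Suc.prems by (auto intro: cable_bwords)
  have c: "braid_eq n (?D @ [?t]) (?t # ?D)"
    using D Suc.prems by (intro braid_eq.sym[OF commute1]) (auto simp: cable_down_def)
  have c': "braid_eq n ([?s] @ (?D @ [?t]) @ (?E @ w)) ([?s] @ (?t # ?D) @ (?E @ w))" if "w \<in> bwords n" for w
    using D Suc.prems that by (intro braid_eq_context[OF c]) auto
  have "cable_down True i (Suc m) @ cable_down True (i + 1) (Suc m) @ [(i, True)]
        = [?s] @ (?D @ [?t]) @ (?E @ [(i, True)])" by (simp add: cable_simps)
  also have "braid_eq n \<dots> ([?s] @ (?t # ?D) @ (?E @ [(i, True)]))"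
    using Suc.prems by (intro c') auto
  also have "\<dots> = [?s, ?t] @ (?D @ ?E @ [(i, True)]) @ []" by simp
  also have "braid_eq n \<dots> ([?s, ?t] @ ([?s] @ ?D @ ?E) @ [])"
    using Suc by (intro braid_eq_context) auto
  also have "\<dots> = [] @ [?s, ?t, ?s] @ (?D @ ?E)" by simp
  also have "braid_eq n \<dots> ([] @ [?t, ?s, ?t] @ (?D @ ?E))"
    using Suc.prems D braid_eq.yang_baxter[of "i + m" n] by (intro braid_eq_context) auto
  also have "\<dots> = [?t] @ ([?s] @ (?t # ?D) @ (?E @ [])) @ []" by simp
  also have "braid_eq n \<dots> ([?t] @ ([?s] @ (?D @ [?t]) @ (?E @ [])) @ [])"
    using Suc.prems D by (intro braid_eq_context braid_eq.sym[OF c']) auto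
  also have "\<dots> = [(i + Suc m, True)] @ cable_down True i (Suc m) @ cable_down True (i + 1) (Suc m)"
    by (simp add: cable_simps)
  finally show ?case .
qed

lemma yang_baxter_mid:
  assumes "i \<ge> 1" "i + m < n"
  shows "braid_eq n (cable_up True i m @ [(i + m, True)] @ cable_down True i m)
                    (cable_down True (i + 1) m @ [(i, True)] @ cable_up True (i + 1) m)"
  using assms
proof (induction m)
  case 0 then show ?case by (auto simp: cable_simps intro!: braid_eq.refl)
next
  case (Suc m)
  let ?U = "cable_up True i m" and ?D = "cable_down True i m"
  let ?V = "cable_up True (i + 1) m" and ?E = "cable_down True (i + 1) m"
  let ?s = "(i + m, True)" and ?t = "(i + m + 1, True)"
  have b: "?U \<in> bwords n" "?D \<in> bwords n" "?V \<in> bwords n" "?E \<in> bwords n"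
    using Suc.prems by (auto intro: cable_bwords)
  have c: "braid_eq n (?t # ?D) (?D @ [?t])" "braid_eq n (?U @ [?t]) (?t # ?U)"
    using b Suc.prems by (intro braid_eq.sym[OF commute1] commute1; auto simp: cable_up_def cable_down_def)+
  have "cable_up True i (Suc m) @ [(i + Suc m, True)] @ cable_down True i (Suc m)
        = ?U @ [?s, ?t, ?s] @ ?D" by (simp add: cable_simps)
  also have "braid_eq n \<dots> (?U @ [?t, ?s, ?t] @ ?D)"
    using Suc.prems b braid_eq.yang_baxter[of "i + m" n] by (intro braid_eq_context) auto
  also have "\<dots> = [] @ (?U @ [?t]) @ ([?s, ?t] @ ?D)" by simp
  also have "braid_eq n \<dots> ([] @ (?t # ?U) @ ([?s, ?t] @ ?D))"
    using Suc.prems b c by (intro braid_eq_context) auto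
  also have "\<dots> = (?t # ?U @ [?s]) @ (?t # ?D) @ []" by simp
  also have "braid_eq n \<dots> ((?t # ?U @ [?s]) @ (?D @ [?t]) @ [])"
    using Suc.prems b c by (intro braid_eq_context) auto
  also have "\<dots> = [?t] @ (?U @ [?s] @ ?D) @ [?t]" by simp
  also have "braid_eq n \<dots> ([?t] @ (?E @ [(i, True)] @ ?V) @ [?t])"
    using Suc b by (intro braid_eq_context) auto
  also have "\<dots> = cable_down True (i + 1) (Suc m) @ [(i, True)] @ cable_up True (i + 1) (Suc m)"
    by (simp add: cable_simps)
  finally show ?case .
qed

lemma yang_baxter_up:
  assumes "i \<ge> 1" "i + m < n"
  shows "braid_eq n ([(i, True)] @ cable_up True (i + 1) m @ cable_up True i m)
                    (cable_up True (i + 1) m @ cable_up True i m @ [(i + m, True)])"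
  using assms
proof (induction m)
  case 0 then show ?case by (auto simp: cable_simps intro!: braid_eq.refl)
next
  case (Suc m)
  let ?U = "cable_up True i m" and ?V = "cable_up True (i + 1) m"
  let ?s = "(i + m, True)" and ?t = "(i + m + 1, True)"
  have b: "?U \<in> bwords n" "?V \<in> bwords n" using Suc.prems by (auto intro: cable_bwords)
  have c: "braid_eq n (?t # ?U) (?U @ [?t])"
    using b Suc.prems by (intro commute1; auto simp: cable_up_def)
  have "[(i, True)] @ cable_up True (i + 1) (Suc m) @ cable_up True i (Suc m)
        = ((i, True) # ?V) @ (?t # ?U) @ [?s]" by (simp add: cable_simps)
  also have "braid_eq n \<dots> (((i, True) # ?V) @ (?U @ [?t]) @ [?s])"
    using Suc.prems b c by (intro braid_eq_context) auto
  also have "\<dots> = [] @ ([(i, True)] @ ?V @ ?U) @ [?t, ?s]" by simp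
  also have "braid_eq n \<dots> ([] @ (?V @ ?U @ [?s]) @ [?t, ?s])"
    using Suc b by (intro braid_eq_context) auto
  also have "\<dots> = (?V @ ?U) @ [?s, ?t, ?s] @ []" by simp
  also have "braid_eq n \<dots> ((?V @ ?U) @ [?t, ?s, ?t] @ [])"
    using Suc.prems b braid_eq.yang_baxter[of "i + m" n] by (intro braid_eq_context) auto
  also have "\<dots> = ?V @ (?U @ [?t]) @ [?s, ?t]" by simp
  also have "braid_eq n \<dots> (?V @ (?t # ?U) @ [?s, ?t])"
    using Suc.prems b c by (intro braid_eq_context braid_eq.sym[OF c]) auto
  also have "\<dots> = cable_up True (i + 1) (Suc m) @ cable_up True i (Suc m) @ [(i + Suc m, True)]"
    by (simp add: cable_simps)
  finally show ?case .
qed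

lemma word_subst_Cons:
  "word_subst ((j, e) # w) i m =
     (if i < j then [(j + m - 1, e)] else if i = j then cable_down e j m
      else if i = j + 1 then cable_up e j m else [(j, e)])
     @ word_subst w (Transposition.transpose j (j + 1) i) m"
  by (auto simp: cable_up_def cable_down_def Transposition.transpose_def)

lemma word_subst_append:
  "word_subst (u @ v) i m = word_subst u i m @ word_subst v (word_perm u i) m"
proof (induction u arbitrary: i)
  case (Cons g u)
  then show ?case by (cases g) (simp only: append_Cons word_subst_Cons word_perm.simps append_assoc)
qed auto

lemma transpose_range:
  "j \<in> {1..<n} \<Longrightarrow> i \<in> {1..n} \<Longrightarrow> Transposition.transpose j (j + 1) i \<in> {1..(n::nat)}"
  by (auto simp: Transposition.transpose_def)

lemma word_perm_range: "w \<in> bwords n \<Longrightarrow> i \<in> {1..n} \<Longrightarrow> word_perm w i \<in> {1..n}"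
  using bij_word_perm bij_betwE by blast

lemma word_subst_bwords:
  "w \<in> bwords n \<Longrightarrow> i \<in> {1..n} \<Longrightarrow> word_subst w i m \<in> bwords (n + m - 1)"
proof (induction w arbitrary: i)
  case (Cons g w)
  obtain j e where g: "g = (j, e)" by force
  have "j \<in> {1..<n}" using Cons.prems g by auto
  then show ?case using Cons transpose_range[of j n i]
    unfolding g word_subst_Cons by (auto intro!: cable_bwords)
qed auto

lemma word_subst_cong:
  assumes "braid_eq n u v" "i \<in> {1..n}"
  shows "braid_eq (n + m - 1) (word_subst u i m) (word_subst v i m)"
  using assms
proof (induction arbitrary: i rule: braid_eq.induct)
  case (refl w) then show ?case by (intro braid_eq.refl word_subst_bwords)
next
  case (sym v w) then show ?case by (blast intro: braid_eq.sym)
next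
  case (trans u v w) then show ?case by (blast intro: braid_eq.trans)
next
  case (append u u' v v')
  have "word_perm u i \<in> {1..n}" using append.hyps(1) append.prems braid_eq_bwords word_perm_range by blast
  then show ?case using append word_perm_cong[OF append.hyps(1)]
    by (auto simp: word_subst_append intro!: braid_eq.append)
next
  case (cancel j e)
  consider "i < j" | "i = j" | "i = j + 1" | "i > j + 1" by linarith
  then show ?case
  proof cases
    case 2
    then show ?thesis using cancel word_inv_right[of "cable_down e j m" "n + m - 1"] cable_bwords(2)[of j m "n + m - 1"]
      by (auto simp: word_subst_Cons cable_inv simp del: word_subst.simps(2))
  next
    case 3
    then show ?thesis using cancel word_inv_right[of "cable_up e j m" "n + m - 1"] cable_bwords(1)[of j m "n + m - 1"]
      by (auto simp: word_subst_Cons cable_inv simp del: word_subst.simps(2))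
  qed (use cancel in \<open>auto simp: word_subst_Cons Transposition.transpose_def simp del: word_subst.simps(2) intro!: braid_eq.cancel\<close>)
next
  case (far j k)
  have c1: "braid_eq (n + m - 1) (g # w) (w @ [g])"
    if "w \<in> bwords (n + m - 1)" "fst g \<in> {1..<n + m - 1}" "snd g" "\<forall>(l, e)\<in>set w. e \<and> (fst g + 2 \<le> l \<or> l + 2 \<le> fst g)" for g w
    using commute1[of w "n + m - 1" "fst g"] that by (cases g) auto
  consider "i < j" | "i = j" | "i = j + 1" | "i > j + 1" "i < k" | "i = k" | "i = k + 1" | "i > k + 1" by linarith
  then show ?case
  proof cases
    case 2
    then have "braid_eq (n + m - 1) (cable_down True j m @ [(k + m - 1, True)]) ((k + m - 1, True) # cable_down True j m)"
      using far by (intro braid_eq.sym[OF c1] cable_bwords) (auto simp: cable_down_def)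
    then show ?thesis using 2 far by (auto simp: word_subst_Cons Transposition.transpose_def simp del: word_subst.simps(2))
  next
    case 3
    then have "braid_eq (n + m - 1) (cable_up True j m @ [(k + m - 1, True)]) ((k + m - 1, True) # cable_up True j m)"
      using far by (intro braid_eq.sym[OF c1] cable_bwords) (auto simp: cable_up_def)
    then show ?thesis using 3 far by (auto simp: word_subst_Cons Transposition.transpose_def simp del: word_subst.simps(2))
  next
    case 5
    then have "braid_eq (n + m - 1) ((j, True) # cable_down True k m) (cable_down True k m @ [(j, True)])"
      using far by (intro c1 cable_bwords) (auto simp: cable_down_def)
    then show ?thesis using 5 far by (auto simp: word_subst_Cons Transposition.transpose_def simp del: word_subst.simps(2))
  next
    case 6
    then have "braid_eq (n + m - 1) ((j, True) # cable_up True k m) (cable_up True k m @ [(j, True)])"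
      using far by (intro c1 cable_bwords) (auto simp: cable_up_def)
    then show ?thesis using 6 far by (auto simp: word_subst_Cons Transposition.transpose_def simp del: word_subst.simps(2))
  qed (use far in \<open>auto simp: word_subst_Cons Transposition.transpose_def simp del: word_subst.simps(2) intro!: braid_eq.far\<close>)
next
  case (yang_baxter j)
  consider "i < j" | "i = j" | "i = j + 1" | "i = j + 2" | "i > j + 2" by linarith
  then show ?case
  proof cases
    case 1
    then have "braid_eq (n + m - 1) [(j + m - 1, True), (j + m - 1 + 1, True), (j + m - 1, True)]
        [(j + m - 1 + 1, True), (j + m - 1, True), (j + m - 1 + 1, True)]"
      using yang_baxter by (intro braid_eq.yang_baxter) auto
    moreover have "j + m - 1 + 1 = j + m" using yang_baxter by auto
    ultimately show ?thesis using 1 yang_baxter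
      by (auto simp: word_subst_Cons Transposition.transpose_def simp del: word_subst.simps(2))
  next
    case 2
    then show ?thesis using yang_baxter yang_baxter_down[of j m "n + m - 1"]
      by (auto simp: word_subst_Cons Transposition.transpose_def simp del: word_subst.simps(2))
  next
    case 3
    then show ?thesis using yang_baxter yang_baxter_mid[of j m "n + m - 1"]
      by (auto simp: word_subst_Cons Transposition.transpose_def simp del: word_subst.simps(2))
  next
    case 4
    then show ?thesis using yang_baxter yang_baxter_up[of j m "n + m - 1"]
      by (auto simp: word_subst_Cons Transposition.transpose_def simp del: word_subst.simps(2))
  next
    case 5
    then show ?thesis using yang_baxter braid_eq.yang_baxter[of j "n + m - 1"]
      by (auto simp: word_subst_Cons Transposition.transpose_def simp del: word_subst.simps(2))
  qed
qed

lemma braid_subst_class: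
  assumes "w \<in> bwords n" "i \<in> {1..n}"
  shows "braid_subst n (braid_class n w) i m = braid_class (n + m - 1) (word_subst w i m)"
proof -
  have "braid_class (n + m - 1) (word_subst v i m) = braid_class (n + m - 1) (word_subst w i m)"
    if "v \<in> braid_class n w" for v
    using that assms by (intro braid_class_eq braid_eq.sym[OF word_subst_cong]) (auto simp: mem_braid_class)
  then show ?thesis
    using assms by (auto simp: braid_subst_def intro: braid_class_self)
qed

subsection \<open>Interpretation of braids\<close>

lemma xset_simps:
  assumes "crossed_gset G X" "group G"
  shows "x \<in> points X \<Longrightarrow> val X x \<in> carrier G"
    and "g \<in> carrier G \<Longrightarrow> x \<in> points X \<Longrightarrow> act X g x \<in> points X"
    and "g \<in> carrier G \<Longrightarrow> h \<in> carrier G \<Longrightarrow> x \<in> points X \<Longrightarrow> act X g (act X h x) = act X (g \<otimes>\<^bsub>G\<^esub> h) x"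
    and "x \<in> points X \<Longrightarrow> act X \<one>\<^bsub>G\<^esub> x = x"
    and "g \<in> carrier G \<Longrightarrow> x \<in> points X \<Longrightarrow> val X (act X g x) = g \<otimes>\<^bsub>G\<^esub> val X x \<otimes>\<^bsub>G\<^esub> inv\<^bsub>G\<^esub> g"
proof -
  interpret group_action G "points X" "\<lambda>g. restrict (act X g) (points X)"
    using assms by (simp add: crossed_gset_def)
  show "x \<in> points X \<Longrightarrow> val X x \<in> carrier G"
    using assms by (auto simp: crossed_gset_def)
  show 1: "act X g x \<in> points X" if "g \<in> carrier G" "x \<in> points X" for g x
    using element_image[of g x "act X g x"] that by simp
  show "g \<in> carrier G \<Longrightarrow> h \<in> carrier G \<Longrightarrow> x \<in> points X \<Longrightarrow> act X g (act X h x) = act X (g \<otimes>\<^bsub>G\<^esub> h) x"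
    using composition_rule[of x g h] 1 by simp
  show "x \<in> points X \<Longrightarrow> act X \<one>\<^bsub>G\<^esub> x = x"
    using id_eq_one by (metis restrict_apply')
  show "g \<in> carrier G \<Longrightarrow> x \<in> points X \<Longrightarrow> val X (act X g x) = g \<otimes>\<^bsub>G\<^esub> val X x \<otimes>\<^bsub>G\<^esub> inv\<^bsub>G\<^esub> g"
    using assms by (simp add: crossed_gset_def)
qed

fun gen_step :: "('g, 'm) monoid_scheme \<Rightarrow> ('g, 'x) xset \<Rightarrow> nat \<times> bool \<Rightarrow> 'x list \<Rightarrow> 'x list" where
  "gen_step G X (j, e) u = (let a = u ! (j - 1); b = u ! j in
     if e then u[j - 1 := act X (val X a) b, j := a]
     else u[j - 1 := b, j := act X (inv\<^bsub>G\<^esub> (val X b)) a])"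

context
  fixes G :: "('g, 'm) monoid_scheme" and X :: "('g, 'x) xset"
  assumes G: "group G" and X: "crossed_gset G X"
begin

lemma xpower_nth: "u \<in> xpower X n \<Longrightarrow> k < n \<Longrightarrow> u ! k \<in> points X"
  by (auto simp: xpower_def)

lemma xpower_update: "u \<in> xpower X n \<Longrightarrow> a \<in> points X \<Longrightarrow> u[k := a] \<in> xpower X n"
  using set_update_subset_insert[of u k a] by (auto simp: xpower_def)

lemma step_xpower: "j \<in> {1..<n} \<Longrightarrow> u \<in> xpower X n \<Longrightarrow> gen_step G X (j, e) u \<in> xpower X n"
proof -
  assume j: "j \<in> {1..<n}" and u: "u \<in> xpower X n"
  have p: "u ! (j - 1) \<in> points X" "u ! j \<in> points X" using j u by (auto intro: xpower_nth)
  then show ?thesis using xset_simps[OF X G] group.inv_closed[OF G]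
    by (cases e) (simp_all add: xpower_update u Let_def)
qed

lemma gen_rel_step: "j \<in> {1..<n} \<Longrightarrow> gen_rel G X n (j, e) = {(u, gen_step G X (j, e) u) | u. u \<in> xpower X n}"
proof -
  assume j: "j \<in> {1..<n}"
  have 1: "v = gen_step G X (j, e) u" if "(u, v) \<in> gen_rel G X n (j, e)" for u v
  proof (rule nth_equalityI)
    show l: "length v = length (gen_step G X (j, e) u)"
      using that by (auto simp: gen_rel_def xpower_def Let_def)
    have *: "length u = n" "length v = n" "\<forall>k<n. k \<noteq> j - 1 \<and> k \<noteq> j \<longrightarrow> v ! k = u ! k"
      and c: "((u ! (j - 1), u ! j), (v ! (j - 1), v ! j)) \<in> crossing G X e"
      using that by (auto simp: gen_rel_def xpower_def)
    have v: "v ! (j - 1) = (if e then act X (val X (u ! (j - 1))) (u ! j) else u ! j)"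
      "v ! j = (if e then u ! (j - 1) else act X (inv\<^bsub>G\<^esub> (val X (u ! j))) (u ! (j - 1)))"
      using c by (auto simp: crossing_def split: if_splits)
    fix k assume k: "k < length v"
    have ne: "j - 1 \<noteq> j" "j - 1 < n" "j < n" using j by auto
    consider "k = j - 1" | "k = j" | "k \<noteq> j - 1" "k \<noteq> j" by blast
    then show "v ! k = gen_step G X (j, e) u ! k"
    proof cases
      case 1 then show ?thesis unfolding 1 v(1) using *(1) ne by (simp add: Let_def)
    next
      case 2 then show ?thesis unfolding 2 v(2) using *(1) ne by (simp add: Let_def)
    next
      case 3
      from *(3) have "k < n \<longrightarrow> k \<noteq> j - 1 \<and> k \<noteq> j \<longrightarrow> v ! k = u ! k" by (rule spec)
      then have "v ! k = u ! k" using *(2) k 3 by simp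
      moreover have "gen_step G X (j, e) u ! k = u ! k" using 3 by (simp add: Let_def)
      ultimately show ?thesis by simp
    qed
  qed
  have 2: "(u, gen_step G X (j, e) u) \<in> gen_rel G X n (j, e)" if "u \<in> xpower X n" for u
  proof -
    have l: "length u = n" "j - 1 \<noteq> j" "j - 1 < n" "j < n" using that j by (auto simp: xpower_def)
    then have "((u ! (j - 1), u ! j), (gen_step G X (j, e) u ! (j - 1), gen_step G X (j, e) u ! j)) \<in> crossing G X e"
      by (cases e) (simp_all add: crossing_def Let_def)
    moreover have "\<forall>k<n. k \<noteq> j - 1 \<and> k \<noteq> j \<longrightarrow> gen_step G X (j, e) u ! k = u ! k"
      by (simp add: Let_def)
    ultimately show ?thesis using step_xpower[OF j that, of e] that unfolding gen_rel_def by blast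
  qed
  have 3: "u \<in> xpower X n" if "(u, v) \<in> gen_rel G X n (j, e)" for u v
    using that unfolding gen_rel_def by blast
  show ?thesis
  proof (intro equalityI subrelI)
    fix u v assume "(u, v) \<in> gen_rel G X n (j, e)"
    with 1[OF this] 3[OF this] show "(u, v) \<in> {(u, gen_step G X (j, e) u) | u. u \<in> xpower X n}" by blast
  next
    fix u v assume "(u, v) \<in> {(u, gen_step G X (j, e) u) | u. u \<in> xpower X n}"
    then show "(u, v) \<in> gen_rel G X n (j, e)" using 2 by blast
  qed
qed

fun word_step where "word_step [] u = u" | "word_step (g # w) u = word_step w (gen_step G X g u)"

lemma word_rel_steps:
  "w \<in> bwords n \<Longrightarrow> word_rel G X n w = {(u, word_step w u) | u. u \<in> xpower X n}"
proof (induction w)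
  case (Cons g w)
  obtain j e where g: "g = (j, e)" by force
  have j: "j \<in> {1..<n}" using Cons.prems g by auto
  show ?case using Cons gen_rel_step[OF j, of e] step_xpower[OF j] g
    by (auto simp: relcomp_unfold simp del: gen_step.simps)
qed auto

lemma steps_xpower: "w \<in> bwords n \<Longrightarrow> u \<in> xpower X n \<Longrightarrow> word_step w u \<in> xpower X n"
  by (induction w arbitrary: u) (auto simp del: gen_step.simps simp: step_xpower)

lemma steps_append: "word_step (v @ w) u = word_step w (word_step v u)"
  by (induction v arbitrary: u) auto

lemma steps_cong: "braid_eq n v w \<Longrightarrow> u \<in> xpower X n \<Longrightarrow> word_step v u = word_step w u"
proof (induction arbitrary: u rule: braid_eq.induct)
  case (append v v' w w')
  then have "word_step v u \<in> xpower X n" using braid_eq_bwords steps_xpower by blast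
  with append show ?case by (simp add: steps_append)
next
  case (cancel j e)
  note s = xset_simps[OF X G]
  obtain i where i: "j = Suc i" using cancel by (cases j) auto
  have l: "length u = n" "i < n" "Suc i < n" using cancel i by (auto simp: xpower_def)
  then have p: "u ! i \<in> points X" "u ! Suc i \<in> points X"
    using cancel.prems xpower_nth by blast+
  then have a: "act X (inv\<^bsub>G\<^esub> val X (u ! i)) (act X (val X (u ! i)) (u ! Suc i)) = u ! Suc i"
    "act X (val X (u ! Suc i)) (act X (inv\<^bsub>G\<^esub> val X (u ! Suc i)) (u ! i)) = u ! i"
    using s G by (simp_all add: group.inv_closed group.l_inv group.r_inv)
  show ?case
  proof (cases e)
    case True
    then show ?thesis using l unfolding i by (simp add: Let_def a(1) list_update_swap)
  next
    case False
    then show ?thesis using l unfolding i by (simp add: Let_def a(2) list_update_swap)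
  qed
next
  case (far i j)
  obtain i' j' where i: "i = Suc i'" "j = Suc j'" using far by (cases i; cases j) auto
  have l: "i' \<noteq> j'" "i' \<noteq> Suc j'" "Suc i' \<noteq> j'" "Suc i' \<noteq> Suc j'" using far i by auto
  have sw: "u[i' := a, Suc i' := b, j' := c, Suc j' := d] = u[j' := c, Suc j' := d, i' := a, Suc i' := b]"
    for a b c d
    using l l[symmetric] by (simp add: list_update_swap[of j' i'] list_update_swap[of "Suc j'" i']
        list_update_swap[of j' "Suc i'"] list_update_swap[of "Suc j'" "Suc i'"])
  show ?case unfolding i using l l[symmetric] by (simp add: Let_def sw)
next
  case (yang_baxter i)
  note s = xset_simps[OF X G]
  interpret group G by (rule G)
  obtain j where i: "i = Suc j" using yang_baxter.hyps(1) by (cases i) auto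
  have l: "length u = n" "j < n" "Suc j < n" "Suc (Suc j) < n" using yang_baxter i by (auto simp: xpower_def)
  let ?a = "u ! j" and ?b = "u ! Suc j" and ?c = "u ! Suc (Suc j)"
  have p: "?a \<in> points X" "?b \<in> points X" "?c \<in> points X"
    using l yang_baxter.prems xpower_nth by blast+
  then have a: "act X (val X (act X (val X ?a) ?b)) (act X (val X ?a) ?c) =
             act X (val X ?a) (act X (val X ?b) ?c)"
    using s by (simp add: inv_closed m_assoc)
  show ?case unfolding i
    using l by (simp add: Let_def a list_update_swap[of "Suc j" j] list_update_swap[of "Suc (Suc j)" j] list_update_swap[of "Suc (Suc j)" "Suc j"])
next
  case (sym v w) show ?case by (rule HOL.sym[OF sym.IH[OF sym.prems]])
next
  case (trans v w x) show ?case by (rule HOL.trans[OF trans.IH(1,2)[OF trans.prems]])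
qed (rule HOL.refl)

lemma braid_rel_class: "w \<in> bwords n \<Longrightarrow> braid_rel G X n (braid_class n w) = word_rel G X n w"
proof -
  assume w: "w \<in> bwords n"
  have "word_rel G X n v = word_rel G X n w" if "v \<in> braid_class n w" for v
  proof -
    have v: "braid_eq n w v" "v \<in> bwords n" using that braid_eq_bwords by (auto simp: mem_braid_class)
    show ?thesis unfolding word_rel_steps[OF w] word_rel_steps[OF v(2)] using steps_cong[OF v(1)] by (intro Collect_cong) metis
  qed
  then show ?thesis using braid_class_self[OF w] unfolding braid_rel_def by (intro equalityI UN_least UN_upper) (metis subset_refl)+
qed
end

section \<open>Contexts and substitution\<close>

lemma carrier_perm:
  assumes "s \<in> carrier (braid_group n)"
  shows "bij_betw (braid_perm s) {1..n} {1..n}"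
  using assms bij_word_perm by (auto simp: braid_group_carrier braid_perm_class)

lemma braid_permute_map:
  assumes "s \<in> carrier (braid_group (length xs))"
  shows "braid_permute s (map f xs) = map f (braid_permute s xs)"
proof -
  have "braid_perm s i - 1 < length xs" if "i \<in> {1..length xs}" for i
    using carrier_perm[OF assms] that by (force dest: bij_betwE)
  then show ?thesis by (auto simp: braid_permute_def)
qed

lemma set_braid_permute:
  assumes "s \<in> carrier (braid_group (length xs))"
  shows "set (braid_permute s xs) = set xs"
proof -
  have "set (braid_permute s xs) = (\<lambda>i. xs ! (i - 1)) ` braid_perm s ` {1..length xs}"
    unfolding braid_permute_def image_image set_map by (intro image_cong) auto
  also have "\<dots> = (\<lambda>i. xs ! (i - 1)) ` {1..length xs}"
    using carrier_perm[OF assms] by (simp add: bij_betw_def)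
  also have "\<dots> = set xs"
    proof (intro equalityI subsetI)
    fix y assume "y \<in> set xs"
    then obtain i where "i < length xs" "y = xs ! i" by (auto simp: in_set_conv_nth)
    then show "y \<in> (\<lambda>i. xs ! (i - 1)) ` {1..length xs}" by (intro image_eqI[of _ _ "Suc i"]) auto
  qed auto
  finally show ?thesis .
qed

fun braids_ok :: "trm \<Rightarrow> bool" where
  "braids_ok (Atom a) = True"
| "braids_ok (App M N) = (braids_ok M \<and> braids_ok N)"
| "braids_ok (Lam M) = braids_ok M"
| "braids_ok (Braid s M) = (braids_ok M \<and> s \<in> carrier (braid_group (length (context_of M))))"

lemma length_permute [simp]: "length (braid_permute s xs) = length xs"
  by (simp add: braid_permute_def del: upt_Suc)

lemma braids_ok_bind:
  "braids_ok M \<Longrightarrow> Bound k \<notin> set (context_of M) \<Longrightarrow>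
   braids_ok (bind_var k x M) \<and> 
   context_of (bind_var k x M) = map (\<lambda>a. if a = Free x then Bound k else a) (context_of M)"
proof (induction M arbitrary: k)
  case (Lam M)
  have "Bound (Suc k) \<notin> set (context_of M)"
    using Lam.prems by (force simp: image_iff split: atom.splits)
  then have "braids_ok (bind_var (Suc k) x M)"
     "context_of (bind_var (Suc k) x M) = map (\<lambda>a. if a = Free x then Bound (Suc k) else a) (context_of M)"
    using Lam by auto
  then show ?case by (auto simp: filter_map o_def split: atom.splits intro!: map_cong filter_cong)
next
  case (Braid s M)
  then show ?case using set_braid_permute[of s "context_of M"] by (auto simp: braid_permute_map)
qed auto

lemma judgement_context_ok: "\<Gamma> \<turnstile> M \<Longrightarrow> context_of M = map Free \<Gamma> \<and> distinct \<Gamma> \<and> braids_ok M"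
proof (induction rule: judgement.induct)
  case (lam \<Gamma> x M)
  have "Bound 0 \<notin> set (context_of M)" using lam.IH by auto
  then have 1: "braids_ok (bind_var 0 x M)"
     "context_of (bind_var 0 x M) = map (\<lambda>a. if a = Free x then Bound 0 else a) (context_of M)"
    using lam.IH braids_ok_bind by auto
  have "filter (\<lambda>y. y \<noteq> x) \<Gamma> = \<Gamma>" using lam.IH by (auto simp: filter_id_conv)
  then show ?case using 1 lam.IH by (auto simp: lam_def filter_map o_def)
next
  case (braid \<Gamma> M s)
  have "bij_betw (braid_perm s) {1..length \<Gamma>} {1..length \<Gamma>}" using carrier_perm braid by blast
  have "set (braid_permute s \<Gamma>) = set \<Gamma>" using braid.hyps set_braid_permute by blast
  then have "distinct (braid_permute s \<Gamma>)"
    using braid.IH by (intro card_distinct) (simp add: distinct_card)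
  then show ?case using braid by (auto simp: braid_permute_map)
qed auto

lemma judgement_context: "\<Gamma> \<turnstile> M \<Longrightarrow> context_of M = map Free \<Gamma>" using judgement_context_ok by blast

lemma subst_fresh: "Free x \<notin> set (context_of M) \<Longrightarrow> braids_ok M \<Longrightarrow> subst M x N = M"
proof (induction M)
  case (Lam M) then show ?case by (force simp: image_iff split: atom.splits)
next
  case (Braid s M) then show ?case by (simp add: set_braid_permute)
qed auto

lemma bind_var_fresh: "braids_ok N \<Longrightarrow> Free y \<notin> set (context_of N) \<Longrightarrow> bind_var k y N = N"
proof (induction N arbitrary: k)
  case (Lam N)
  then show ?case by (force simp: image_iff split: atom.splits)
next
  case (Braid s N) then show ?case by (simp add: set_braid_permute)
qed auto

lemma subst_bind_var:
  assumes "x \<noteq> y" "\<And>k. bind_var k y N = N"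
  shows "braids_ok M \<Longrightarrow> Bound k \<notin> set (context_of M) \<Longrightarrow>
           subst (bind_var k y M) x N = bind_var k y (subst M x N)"
proof (induction M arbitrary: k)
  case (Lam M)
  have "Bound (Suc k) \<notin> set (context_of M)"
    using Lam.prems by (force simp: image_iff split: atom.splits)
  then show ?case using Lam by simp
next
  case (Braid s M)
  let ?f = "\<lambda>a. if a = Free y then Bound k else a"
  have b: "Bound k \<notin> set (context_of M)" "braids_ok M"
    using Braid.prems by (auto simp: set_braid_permute)
  have c: "context_of (bind_var k y M) = map ?f (context_of M)"
    using braids_ok_bind b by blast
  have "((\<lambda>a. a \<noteq> Free x) \<circ> ?f) = (\<lambda>a. a \<noteq> Free x)" using assms(1) by (auto simp: fun_eq_iff)
  then have t: "length (takeWhile (\<lambda>a. a \<noteq> Free x) (map ?f (context_of M))) =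
             length (takeWhile (\<lambda>a. a \<noteq> Free x) (context_of M))"
    by (simp add: takeWhile_map)
  have m: "Free x \<in> set (map ?f (context_of M)) \<longleftrightarrow> Free x \<in> set (context_of M)"
    using assms(1) by auto
  show ?case using Braid.IH[OF b(2,1)]
    by (simp only: subst.simps bind_var.simps c t m Let_def length_map split: if_split) simp
qed (use assms in auto)

lemma subst_lam:
  assumes "\<Gamma> @ [y] \<turnstile> M" "\<Delta> \<turnstile> N" "y \<notin> set \<Delta>" "x \<noteq> y"
  shows "subst (lam y M) x N = lam y (subst M x N)"
proof -
  have "bind_var k y N = N" for k
    using judgement_context_ok[OF assms(2)] assms(3) by (intro bind_var_fresh) auto
  then show ?thesis
    using judgement_context_ok[OF assms(1)] subst_bind_var[OF assms(4), of N M 0] by (simp add: lam_def) force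
qed

lemma subst_braid:
  assumes "\<Gamma> \<turnstile> M" "\<Delta> \<turnstile> N" "i \<in> {1..length \<Gamma>}"
  shows "subst (Braid s M) (\<Gamma> ! (i - 1)) N =
           Braid (braid_subst (length \<Gamma>) s (inv_into {1..length \<Gamma>} (braid_perm s) i) (length \<Delta>))
             (subst M (\<Gamma> ! (i - 1)) N)"
proof -
  have d: "distinct \<Gamma>" "context_of M = map Free \<Gamma>" "context_of N = map Free \<Delta>"
    using judgement_context_ok assms by blast+
  have i: "i - 1 < length \<Gamma>" "Suc (i - 1) = i" using assms(3) by auto
  have "takeWhile (\<lambda>a. a \<noteq> Free (\<Gamma> ! (i - 1))) (map Free \<Gamma>) = take (i - 1) (map Free \<Gamma>)"
    using d(1) i by (intro takeWhile_eq_take_P_nth) (auto simp: nth_eq_iff_index_eq)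
  then have t: "length (takeWhile (\<lambda>a. a \<noteq> Free (\<Gamma> ! (i - 1))) (map Free \<Gamma>)) = i - 1"
    using i by simp
  have m: "Free (\<Gamma> ! (i - 1)) \<in> set (map Free \<Gamma>)" using i by simp
  show ?thesis unfolding subst.simps d Let_def t length_map if_P[OF m] using i by simp
qed

end

theory Submission
  imports Defs "HOL-Library.Multiset"
begin

text \<open>
  Every denotation is a morphism of \<open>XRel(G)\<close>: it preserves valuations and is equivariant. A tuple
  thus crosses another strand exactly as the single value it denotes does, the crossing acting on
  all of its entries by the same group element. This gives the substitution property
  for braids, replacing a strand by \<open>m\<close> parallel strands, and with it soundness of \<open>\<beta>\<close>; soundness
  of \<open>\<beta>\<close> and \<open>\<eta>\<close> otherwise only uses that \<open>\<phi>\<close> is injective and onto.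
\<close>

text \<open>The root entry |\<phi>(b,a)| = |b||a|^{-1} is what makes abstraction and application
  preserve valuations: it carries |a| from one side of |u||a| = |b| to the other. On the syntactic
  side the obstacle is that \<open>lam x M\<close> forgets \<open>x\<close>: a derivation cannot be
  inverted to one about a fixed body, and a substitution has to be followed under binders, where
  contexts contain bound indices. The semantic equations are therefore proved for raw terms under a
  structural invariant, with substitution interpreted as plugging one relation into a position of
  another. Since braids reorder contexts, the context of a substituted term is tracked only up to
  order.\<close>

section \<open>Crossed G-sets: action laws, isomorphisms from bijections, tensor and dual\<close>

lemma crossed_gsetI:
  fixes G :: "('g, 'm) monoid_scheme" (structure) and X :: "('g, 'x) xset"
  assumes "group G"
    and closed: "\<And>g x. g \<in> carrier G \<Longrightarrow> x \<in> points X \<Longrightarrow> act X g x \<in> points X"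
    and mult: "\<And>g h x. g \<in> carrier G \<Longrightarrow> h \<in> carrier G \<Longrightarrow> x \<in> points X \<Longrightarrow>
                 act X g (act X h x) = act X (g \<otimes> h) x"
    and one: "\<And>x. x \<in> points X \<Longrightarrow> act X \<one> x = x"
    and val: "\<And>x. x \<in> points X \<Longrightarrow> val X x \<in> carrier G"
    and val_act: "\<And>g x. g \<in> carrier G \<Longrightarrow> x \<in> points X \<Longrightarrow> val X (act X g x) = g \<otimes> val X x \<otimes> inv g"
  shows "crossed_gset G X"
proof -
  interpret group G by fact
  \<comment> \<open>\<open>group_action\<close> asks for a homomorphism into the group of
    bijections; the inverse map of the action of \<open>g\<close> is the action of
    \<open>inv g\<close>.\<close>
  have bij: "restrict (act X g) (points X) \<in> Bij (points X)" if "g \<in> carrier G" for g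
    using that by (auto simp: Bij_def closed mult one intro!: bij_betwI[where g = "act X (inv g)"])
  have "group_hom G (BijGroup (points X)) (\<lambda>g. restrict (act X g) (points X))"
    using is_group group_BijGroup bij
    by (auto simp: group_hom_def group_hom_axioms_def hom_def BijGroup_def compose_def restrict_def
        closed mult intro!: ext)
  then show ?thesis
    using val val_act by (auto simp: crossed_gset_def group_action_def)
qed

lemma (in group) inv_cancel_left:
  assumes "g \<in> carrier G" "x \<in> carrier G"
  shows "inv g \<otimes> (g \<otimes> x) = x" "g \<otimes> (inv g \<otimes> x) = x"
  using assms by (simp_all flip: m_assoc)

text \<open>The inverse morphism is the converse relation, and equivariance of \<open>f\<close> read
  backwards makes it equivariant.\<close>

lemma xrel_iso_graph:
  assumes X: "crossed_gset G X" and Y: "crossed_gset G Y" and G: "group G"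
    and f: "bij_betw f (points X) (points Y)"
    and val: "\<And>x. x \<in> points X \<Longrightarrow> val Y (f x) = val X x"
    and act: "\<And>g x. g \<in> carrier G \<Longrightarrow> x \<in> points X \<Longrightarrow> act Y g (f x) = f (act X g x)"
  shows "xrel_iso G X Y {(x, f x) | x. x \<in> points X}"
proof -
  let ?r = "{(x, f x) | x. x \<in> points X}"
  have f': "\<And>x. x \<in> points X \<Longrightarrow> f x \<in> points Y" "inj_on f (points X)" "f ` points X = points Y"
    using f by (auto simp: bij_betw_def)
  have hom: "?r \<in> xrel_hom G X Y" "?r\<inverse> \<in> xrel_hom G Y X"
    using f'(1) val act xset_simps(2)[OF X G] by (auto simp: xrel_hom_def)
  have "?r O ?r\<inverse> = Id_on (points X)" using f'(2) by (auto simp: inj_on_def)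
  moreover have "?r\<inverse> O ?r = Id_on (points Y)" using f'(3) by blast
  ultimately show ?thesis using X Y hom unfolding xrel_iso_def by blast
qed

lemma crossed_xtensor:
  assumes X: "crossed_gset G X" and Y: "crossed_gset G Y" and G: "group G"
  shows "crossed_gset G (xtensor G X Y)"
proof -
  interpret group G by fact
  note x = xset_simps[OF X G] and y = xset_simps[OF Y G]
  show ?thesis
    by (rule crossed_gsetI[OF G]) (auto simp: xtensor_def x y m_assoc inv_cancel_left)
qed

lemma crossed_xdual:
  assumes X: "crossed_gset G X" and G: "group G"
  shows "crossed_gset G (xdual G X)"
proof -
  interpret group G by fact
  note x = xset_simps[OF X G]
  show ?thesis
    by (rule crossed_gsetI[OF G]) (auto simp: xdual_def x m_assoc inv_mult_group)
qed

section \<open>The crossed G-set of trees\<close>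

lemma tree_xset_simps [simp]:
  "points (tree_xset G) = tree_set G"
  "act (tree_xset G) g f w = g \<otimes>\<^bsub>G\<^esub> f w \<otimes>\<^bsub>G\<^esub> inv\<^bsub>G\<^esub> g"
  "val (tree_xset G) f = f []"
  by (simp_all add: tree_xset_def)

lemma tree_phi_simps [simp]:
  "tree_phi G a b [] = a [] \<otimes>\<^bsub>G\<^esub> inv\<^bsub>G\<^esub> (b [])"
  "tree_phi G a b (False # w) = a w"
  "tree_phi G a b (True # w) = b w"
  by (simp_all add: tree_phi_def)

lemma tree_phi_inject [simp]: "tree_phi G a b = tree_phi G a' b' \<longleftrightarrow> a = a' \<and> b = b'"
  by (auto simp: fun_eq_iff tree_phi_def split: list.splits)

lemma tree_setD:
  assumes "f \<in> tree_set G"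
  shows "f w \<in> carrier G" "f w = f (w @ [False]) \<otimes>\<^bsub>G\<^esub> inv\<^bsub>G\<^esub> (f (w @ [True]))"
  using assms unfolding tree_set_def by blast+

lemma tree_setI:
  assumes "\<And>w. f w \<in> carrier G \<and> f w = f (w @ [False]) \<otimes>\<^bsub>G\<^esub> inv\<^bsub>G\<^esub> (f (w @ [True]))"
  shows "f \<in> tree_set G"
  unfolding tree_set_def using assms by blast

lemma tree_phi_in_tree_set [simp]:
  assumes "group G"
  shows "tree_phi G a b \<in> tree_set G \<longleftrightarrow> a \<in> tree_set G \<and> b \<in> tree_set G"
proof
  assume *: "tree_phi G a b \<in> tree_set G"
  have "a w \<in> carrier G \<and> a w = a (w @ [False]) \<otimes>\<^bsub>G\<^esub> inv\<^bsub>G\<^esub> (a (w @ [True]))"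
    "b w \<in> carrier G \<and> b w = b (w @ [False]) \<otimes>\<^bsub>G\<^esub> inv\<^bsub>G\<^esub> (b (w @ [True]))" for w
    using tree_setD[OF *, of "False # w"] tree_setD[OF *, of "True # w"] by simp_all
  then show "a \<in> tree_set G \<and> b \<in> tree_set G" using tree_setI[of a] tree_setI[of b] by blast
next
  interpret group G by fact
  assume *: "a \<in> tree_set G \<and> b \<in> tree_set G"
  then have "tree_phi G a b w \<in> carrier G \<and>
      tree_phi G a b w = tree_phi G a b (w @ [False]) \<otimes>\<^bsub>G\<^esub> inv\<^bsub>G\<^esub> (tree_phi G a b (w @ [True]))" for w
    using tree_setD[of a G "tl w"] tree_setD[of b G "tl w"] tree_setD(1)[of _ G "[]"]
    by (cases w; cases "hd w") simp_all
  then show "tree_phi G a b \<in> tree_set G" by (rule tree_setI)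
qed

text \<open>Surjectivity of \<phi>: a tree is rebuilt from its two children because its root entry
  is forced by the defining equation of \<open>tree_set\<close> at the empty word.\<close>

lemma tree_phi_children:
  assumes "f \<in> tree_set G"
  shows "tree_phi G (\<lambda>w. f (False # w)) (\<lambda>w. f (True # w)) = f"
proof
  fix w
  show "tree_phi G (\<lambda>w. f (False # w)) (\<lambda>w. f (True # w)) w = f w"
    using tree_setD(2)[OF assms, of "[]"] by (cases w; cases "hd w") auto
qed

lemma children_in_tree_set:
  assumes "f \<in> tree_set G"
  shows "(\<lambda>w. f (b # w)) \<in> tree_set G"
proof (rule tree_setI)
  fix w
  show "f (b # w) \<in> carrier G \<and>
      f (b # w) = f (b # w @ [False]) \<otimes>\<^bsub>G\<^esub> inv\<^bsub>G\<^esub> (f (b # w @ [True]))"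
    using tree_setD[OF assms, of "b # w"] by simp
qed

context
  fixes G :: "('g, 'm) monoid_scheme" (structure)
  assumes G: "group G"
begin

interpretation group G by (rule G)

text \<open>Conjugation is a homomorphism, so it respects the quotient at the root; below the root
  it acts on the children separately.\<close>

lemma act_tree_phi:
  assumes "g \<in> carrier G" "a \<in> tree_set G" "b \<in> tree_set G"
  shows "act (tree_xset G) g (tree_phi G a b) = tree_phi G (act (tree_xset G) g a) (act (tree_xset G) g b)"
proof
  fix w
  show "act (tree_xset G) g (tree_phi G a b) w = tree_phi G (act (tree_xset G) g a) (act (tree_xset G) g b) w"
    using assms(1) tree_setD(1)[OF assms(2)] tree_setD(1)[OF assms(3)]
    by (cases w; cases "hd w") (auto simp: inv_mult_group m_assoc inv_cancel_left)
qed

lemma crossed_tree_xset: "crossed_gset G (tree_xset G)"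
proof (rule crossed_gsetI[OF G])
  fix g f assume g: "g \<in> carrier G" and f: "f \<in> points (tree_xset G)"
  then have f': "\<And>w. f w \<in> carrier G" using tree_setD(1)[of f G] by simp
  have "act (tree_xset G) g f w \<in> carrier G \<and> act (tree_xset G) g f w = act (tree_xset G) g f (w @ [False]) \<otimes> inv (act (tree_xset G) g f (w @ [True]))" for w
    using g f' tree_setD(2)[of f G w] f by (simp add: inv_mult_group m_assoc inv_cancel_left)
  then show "act (tree_xset G) g f \<in> points (tree_xset G)"
    unfolding tree_xset_simps(1) by (rule tree_setI)
  fix h assume "h \<in> carrier G"
  then show "act (tree_xset G) g (act (tree_xset G) h f) = act (tree_xset G) (g \<otimes> h) f"
    using g f' by (auto simp: inv_mult_group m_assoc)
qed (auto simp: tree_setD(1))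

lemma bij_tree_phi: "bij_betw (\<lambda>(a, b). tree_phi G a b) (tree_set G \<times> tree_set G) (tree_set G)"
proof (rule bij_betwI)
  show "(\<lambda>f. (\<lambda>w. f (False # w), \<lambda>w. f (True # w))) \<in> tree_set G \<rightarrow> tree_set G \<times> tree_set G"
    using children_in_tree_set by blast
qed (auto simp: G tree_phi_children)

text \<open>The valuation of \<open>(a, b)\<close> in the tensor with the dual is |a||b|^{-1}, which
  is exactly the root entry that \<open>tree_phi\<close> writes.\<close>

lemma iso_tree_phi:
  "xrel_iso G (xtensor G (tree_xset G) (xdual G (tree_xset G))) (tree_xset G)
     {((a, b), tree_phi G a b) | a b. a \<in> tree_set G \<and> b \<in> tree_set G}"
proof -
  let ?X = "xtensor G (tree_xset G) (xdual G (tree_xset G))"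
  have p: "points ?X = tree_set G \<times> tree_set G" by (simp add: xtensor_def xdual_def)
  have "xrel_iso G ?X (tree_xset G) {(x, (\<lambda>(a, b). tree_phi G a b) x) | x. x \<in> points ?X}"
  proof (rule xrel_iso_graph)
    show "bij_betw (\<lambda>(a, b). tree_phi G a b) (points ?X) (points (tree_xset G))"
      unfolding p using bij_tree_phi by simp
  qed (use G in \<open>auto simp: p crossed_tree_xset crossed_xtensor crossed_xdual act_tree_phi\<close>,
       auto simp: xtensor_def xdual_def)
  moreover have "{(x, (\<lambda>(a, b). tree_phi G a b) x) | x. x \<in> points ?X} =
      {((a, b), tree_phi G a b) | a b. a \<in> tree_set G \<and> b \<in> tree_set G}"
    unfolding p by auto
  ultimately show ?thesis by simp
qed

lemma tree_star_in_tree_set: "f \<in> tree_set G \<Longrightarrow> tree_star G f \<in> tree_set G"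
  by (simp add: tree_star_def G children_in_tree_set)

lemma tree_star_tree_star: "f \<in> tree_set G \<Longrightarrow> tree_star G (tree_star G f) = f"
  by (simp add: tree_star_def tree_phi_children)

text \<open>Swapping the children inverts the root entry, as (xy^{-1})^{-1} = yx^{-1}, and the
  valuation of the dual inverts it back. Bijectivity holds because \<open>tree_star\<close> is an
  involution.\<close>

lemma iso_tree_star:
  "xrel_iso G (tree_xset G) (xdual G (tree_xset G)) {(f, tree_star G f) | f. f \<in> tree_set G}"
proof -
  have "xrel_iso G (tree_xset G) (xdual G (tree_xset G)) {(f, tree_star G f) | f. f \<in> points (tree_xset G)}"
  proof (rule xrel_iso_graph)
    show "bij_betw (tree_star G) (points (tree_xset G)) (points (xdual G (tree_xset G)))"
      by (rule bij_betwI[where g = "tree_star G"])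
        (auto simp: xdual_def tree_star_in_tree_set tree_star_tree_star)
  next
    fix f assume "f \<in> points (tree_xset G)"
    then have f: "f \<in> tree_set G" by simp
    show "val (xdual G (tree_xset G)) (tree_star G f) = val (tree_xset G) f"
      using tree_setD(2)[OF f, of "[]"] tree_setD(1)[OF f]
      by (simp add: xdual_def tree_star_def inv_mult_group)
    fix g assume "g \<in> carrier G"
    moreover have "(\<lambda>w. act (tree_xset G) g f (b # w)) = act (tree_xset G) g (\<lambda>w. f (b # w))" for b
      by auto
    ultimately show "act (xdual G (tree_xset G)) g (tree_star G f) = tree_star G (act (tree_xset G) g f)"
      using f by (simp add: xdual_def tree_star_def act_tree_phi children_in_tree_set del: tree_xset_simps(2))
  qed (use G in \<open>auto simp: crossed_tree_xset crossed_xdual\<close>)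
  then show ?thesis by simp
qed

end

declare tree_xset_simps(2) [simp del]

section \<open>Braids acting on tuples\<close>

text \<open>Trades list updates for concatenation, the form used in the computations below. Strands
  count from 1 and list positions from 0, so generator \<open>Suc k\<close> acts on the two entries
  after a prefix of length \<open>k\<close>.\<close>

lemma gen_step_append_mid:
  "length p = k \<Longrightarrow> gen_step G X (Suc k, e) (p @ a # b # q) =
     p @ (if e then [act X (val X a) b, a] else [b, act X (inv\<^bsub>G\<^esub> (val X b)) a]) @ q"
  by (auto simp: Let_def nth_append list_update_append)

lemma gen_step_append_left:
  "j \<in> {1..<length u} \<Longrightarrow> gen_step G X (j, e) (u @ v) = gen_step G X (j, e) u @ v"
  by (auto simp: Let_def nth_append list_update_append)

lemma gen_step_append_right:
  "j \<ge> 1 \<Longrightarrow> gen_step G X (length u + j, e) (u @ v) = u @ gen_step G X (j, e) v"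
  by (auto simp: Let_def nth_append list_update_append)

lemma split_at_crossing:
  assumes "j \<in> {1..<length u}"
  obtains p a b q where "u = p @ a # b # q" "j = Suc (length p)"
proof
  show "u = take (j - 1) u @ u ! (j - 1) # u ! j # drop (j + 1) u"
    using assms id_take_nth_drop[of "j - 1" u] Cons_nth_drop_Suc[of j u] by (cases j) auto
qed (use assms in auto)

text \<open>The valuation of the iterated tensor power; with the entrywise action
  \<open>map (act X g)\<close> it makes tuples a crossed G-set.\<close>

definition tuple_val :: "('g, 'm) monoid_scheme \<Rightarrow> ('g, 'x) xset \<Rightarrow> 'x list \<Rightarrow> 'g" where
  "tuple_val G X u = foldr (\<lambda>x g. val X x \<otimes>\<^bsub>G\<^esub> g) u \<one>\<^bsub>G\<^esub>"

lemma tuple_val_simps [simp]: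
  "tuple_val G X [] = \<one>\<^bsub>G\<^esub>"
  "tuple_val G X (x # u) = val X x \<otimes>\<^bsub>G\<^esub> tuple_val G X u"
  by (simp_all add: tuple_val_def)

text \<open>The composite of id \<otimes> \<open>R\<close> \<otimes> id with \<open>S\<close>, where
  \<open>k\<close> strands precede the output of \<open>R\<close>: the relational counterpart of
  substitution. Positions count from 0 here.\<close>

definition plug :: "nat \<Rightarrow> ('x list \<times> 'x) set \<Rightarrow> ('x list \<times> 'y) set \<Rightarrow> ('x list \<times> 'y) set" where
  "plug k R S = {(u @ v @ z, b) | u v z b. length u = k \<and> (\<exists>a. (v, a) \<in> R \<and> (u @ [a] @ z, b) \<in> S)}"

context
  fixes G :: "('g, 'm) monoid_scheme" (structure) and X :: "('g, 'x) xset"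
  assumes G: "group G" and X: "crossed_gset G X"
begin

interpretation group G by (rule G)

lemmas xset = xset_simps[OF X G]

lemma word_step_simps [simp]:
  "word_step G X [] u = u"
  "word_step G X (g # w) u = word_step G X w (gen_step G X g u)"
  using word_step.simps[OF G X] by auto

lemma tuple_val_closed [simp]: "set u \<subseteq> points X \<Longrightarrow> tuple_val G X u \<in> carrier G"
  by (induction u) (auto simp: xset)

lemma tuple_val_append:
  "set u \<subseteq> points X \<Longrightarrow> set v \<subseteq> points X \<Longrightarrow>
   tuple_val G X (u @ v) = tuple_val G X u \<otimes> tuple_val G X v"
  by (induction u) (auto simp: xset m_assoc)

lemma tuple_val_map_act:
  "g \<in> carrier G \<Longrightarrow> set u \<subseteq> points X \<Longrightarrow>
   tuple_val G X (map (act X g) u) = g \<otimes> tuple_val G X u \<otimes> inv g"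
  by (induction u) (auto simp: xset m_assoc inv_cancel_left)

lemma map_act_one [simp]: "set u \<subseteq> points X \<Longrightarrow> map (act X \<one>) u = u"
  by (induction u) (auto simp: xset)

lemma map_act_inv:
  assumes "g \<in> carrier G" "set u \<subseteq> points X"
  shows "map (act X (inv g)) (map (act X g) u) = u"
  using assms(2) by (induction u) (auto simp: xset assms(1))

lemma map_act_mult:
  assumes "g \<in> carrier G" "h \<in> carrier G" "set u \<subseteq> points X"
  shows "map (act X g) (map (act X h) u) = map (act X (g \<otimes> h)) u"
  using assms(3) by (induction u) (auto simp: xset assms(1,2))

lemma map_act_points: "g \<in> carrier G \<Longrightarrow> set u \<subseteq> points X \<Longrightarrow> set (map (act X g) u) \<subseteq> points X"
  by (auto simp: xset)

lemma gen_step_points: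
  assumes "j \<in> {1..<length u}" "set u \<subseteq> points X"
  shows "set (gen_step G X (j, e) u) \<subseteq> points X \<and> length (gen_step G X (j, e) u) = length u"
  using step_xpower[OF G X assms(1), of u e] assms(2) by (auto simp: xpower_def)

text \<open>Rests on |ga| = g|a|g^{-1}: acting with this element on gb gives g(|a|b), and similarly
  for the inverse crossing.\<close>

lemma gen_step_map_act:
  assumes "j \<in> {1..<length u}" "set u \<subseteq> points X" "g \<in> carrier G"
  shows "gen_step G X (j, e) (map (act X g) u) = map (act X g) (gen_step G X (j, e) u)"
proof -
  obtain p a b q where u: "u = p @ a # b # q" "j = Suc (length p)"
    using split_at_crossing[OF assms(1)] .
  show ?thesis using assms(2,3) unfolding u map_append list.map
    by (subst (1 2) gen_step_append_mid) (auto simp: xset m_assoc inv_cancel_left inv_mult_group)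
qed

text \<open>For a positive crossing, (|a||b||a|^{-1})|a| = |a||b|; for a negative one,
  |b|(|b|^{-1}|a||b|) = |a||b|.\<close>

lemma tuple_val_gen_step:
  assumes "j \<in> {1..<length u}" "set u \<subseteq> points X"
  shows "tuple_val G X (gen_step G X (j, e) u) = tuple_val G X u"
proof -
  obtain p a b q where u: "u = p @ a # b # q" "j = Suc (length p)"
    using split_at_crossing[OF assms(1)] .
  show ?thesis using assms(2) unfolding u
    by (subst gen_step_append_mid) (auto simp: xset m_assoc inv_cancel_left tuple_val_append)
qed

text \<open>Braids act by morphisms of the tensor power: the third and fourth items serve the braid
  case of \<open>sem_typed\<close>. The fifth is the action of s \<otimes> id.\<close>

lemma word_step_props:
  assumes "w \<in> bwords (length u)" "set u \<subseteq> points X"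
  shows "set (word_step G X w u) \<subseteq> points X" "length (word_step G X w u) = length u"
    "tuple_val G X (word_step G X w u) = tuple_val G X u"
    "g \<in> carrier G \<Longrightarrow> word_step G X w (map (act X g) u) = map (act X g) (word_step G X w u)"
    "word_step G X w (u @ v) = word_step G X w u @ v"
  using assms
proof (induction w arbitrary: u)
  case (Cons h w)
  obtain j e where h: "h = (j, e)" by force
  { case 1 then show ?case using Cons gen_step_points by (simp add: h del: gen_step.simps) }
  { case 2 then show ?case using Cons gen_step_points by (simp add: h del: gen_step.simps) }
  { case 3 then show ?case using Cons gen_step_points
      by (simp add: h tuple_val_gen_step del: gen_step.simps) }
  { case 4 then show ?case using Cons gen_step_points
      by (simp add: h gen_step_map_act del: gen_step.simps) }
  { case 5 then show ?case using Cons gen_step_points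
      by (simp add: h gen_step_append_left del: gen_step.simps) }
qed auto

lemma word_step_shift:
  assumes "length u = n" "w \<in> bwords m"
  shows "word_step G X (map (\<lambda>(j, e). (n + j, e)) w) (u @ v) = u @ word_step G X w v"
  using assms
proof (induction w arbitrary: v)
  case (Cons h w)
  obtain j e where h: "h = (j, e)" by force
  show ?case using Cons gen_step_append_right[of j G X u e v] by (simp add: h del: gen_step.simps)
qed auto

section \<open>Cabled strands: the action of a braid with one strand replaced by a block\<close>

text \<open>The entry \<open>b\<close> travels left through the block. Under positive crossings it
  collects the valuations of the block, last entry first, whose product is
  \<open>tuple_val G X v\<close>; under negative ones \<open>b\<close> is unchanged and every entry
  of the block is acted on by |b|^{-1}. The last entry meets \<open>b\<close> first, hence the
  reverse induction.\<close>

lemma word_step_cable_down: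
  assumes "set v \<subseteq> points X" "b \<in> points X"
  shows "word_step G X (cable_down e (Suc (length p)) (length v)) (p @ v @ b # q) =
    p @ (if e then act X (tuple_val G X v) b # v else b # map (act X (inv (val X b))) v) @ q"
  using assms
proof (induction v arbitrary: b q rule: rev_induct)
  case (snoc x v)
  have "gen_step G X (Suc (length (p @ v)), e) ((p @ v) @ x # b # q) =
     (p @ v) @ (if e then [act X (val X x) b, x] else [b, act X (inv (val X b)) x]) @ q"
    by (rule gen_step_append_mid) simp
  then show ?case using snoc.prems snoc.IH[of "act X (val X x) b" "x # q"]
      snoc.IH[of b "act X (inv (val X b)) x # q"]
    by (cases e) (auto simp: cable_simps xset tuple_val_append simp del: gen_step.simps)
qed (auto simp: cable_simps xset)

text \<open>The mirror case, with \<open>a\<close> travelling right: now positive crossings act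
  uniformly on the block, and negative ones make \<open>a\<close> collect the inverse valuations,
  first entry first, so that the inverse of the whole product results.\<close>

lemma word_step_cable_up:
  assumes "set v \<subseteq> points X" "a \<in> points X"
  shows "word_step G X (cable_up e (Suc (length p)) (length v)) (p @ a # v @ q) =
    p @ (if e then map (act X (val X a)) v @ [a] else v @ [act X (inv (tuple_val G X v)) a]) @ q"
  using assms
proof (induction v arbitrary: p a)
  case (Cons x v)
  show ?case
  proof (cases e)
    case True
    then show ?thesis using Cons.prems Cons.IH[of a "p @ [act X (val X a) x]"]
      by (simp add: cable_up_Cons gen_step_append_mid del: gen_step.simps)
  next
    case False
    then show ?thesis using Cons.prems Cons.IH[of "act X (inv (val X x)) a" "p @ [x]"]
      by (simp add: cable_up_Cons gen_step_append_mid xset inv_mult_group del: gen_step.simps)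
  qed
qed (auto simp: cable_simps xset)

text \<open>Neighbours feel the block only through \<open>tuple_val\<close>, so a single entry of
  equal valuation affects them alike. The block itself is moved by \<one> unless it is the left
  partner of a negative crossing (\<open>i = j\<close>) or the right partner of a positive one
  (\<open>i = j + 1\<close>). The data \<open>u'\<close>, \<open>z'\<close>, \<open>g\<close> are
  fixed before \<open>a\<close>: in \<open>word_rel_plug\<close> one direction starts from the tuple
  alone and has yet to find \<open>a\<close>.\<close>

lemma gen_subst_step:
  assumes j: "j \<in> {1..<n}" and i: "i \<in> {1..n}"
    and l: "length u = i - 1" "length z = n - i"
    and p: "set u \<subseteq> points X" "set v \<subseteq> points X" "set z \<subseteq> points X"
  obtains u' z' g where "g \<in> carrier G" "set u' \<subseteq> points X" "set z' \<subseteq> points X"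
    "length u' = Transposition.transpose j (j + 1) i - 1"
    "length z' = n - Transposition.transpose j (j + 1) i"
    "word_step G X (word_subst [(j, e)] i (length v)) (u @ v @ z) = u' @ map (act X g) v @ z'"
    "\<And>a. a \<in> points X \<Longrightarrow> val X a = tuple_val G X v \<Longrightarrow>
       gen_step G X (j, e) (u @ [a] @ z) = u' @ [act X g a] @ z'"
proof -
  let ?m = "length v"
  note [simp del] = gen_step.simps word_subst.simps(2)
  consider "i < j" | "i = j" | "i = j + 1" | "i > j + 1" by linarith
  then show thesis
  proof cases
    case 1
    then have k: "j - i \<in> {1..<length z}" using j i l by auto
    \<comment> \<open>A crossing to the right of the block hits the same place \<open>j - i\<close>
      of \<open>z\<close> in both pictures; replacing one entry by \<open>?m\<close> entries shifts
      its index by \<open>?m - 1\<close>.\<close>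
    have e1: "j + ?m - 1 = length (u @ v) + (j - i)" using 1 l i by auto
    have e2: "j = length (u @ [a]) + (j - i)" for a using 1 l i by auto
    have "gen_step G X (j + ?m - 1, e) ((u @ v) @ z) = (u @ v) @ gen_step G X (j - i, e) z"
      unfolding e1 using k by (intro gen_step_append_right) auto
    moreover have "gen_step G X (j, e) ((u @ [a]) @ z) = (u @ [a]) @ gen_step G X (j - i, e) z" for a
      using k gen_step_append_right[of "j - i" G X "u @ [a]"] e2[of a] by simp
    ultimately show thesis
      using 1 p l k gen_step_points[OF k p(3)]
      by (intro that[of "\<one>" u "gen_step G X (j - i, e) z"])
        (auto simp: word_subst_Cons Transposition.transpose_def xset)
  next
    case 2
    then obtain b q where z: "z = b # q" using j l by (cases z) auto
    have jl: "j = Suc (length u)" "i = Suc (length u)" using 2 i l by auto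
    show thesis
      using p l(2) word_step_cable_down[of v b e u q]
      by (intro that[of "if e then \<one> else inv (val X b)"
            "u @ [if e then act X (tuple_val G X v) b else b]" q])
        (auto simp: z jl word_subst_Cons xset gen_step_append_mid)
  next
    case 3
    then obtain q a where u: "u = q @ [a]" using j l by (cases u rule: rev_cases) auto
    have jl: "j = Suc (length q)" using 3 l u by auto
    show thesis
      using 3 p l i word_step_cable_up[of v a e q z]
      by (intro that[of "if e then val X a else \<one>" q
            "(if e then a else act X (inv (tuple_val G X v)) a) # z"])
        (auto simp: u jl word_subst_Cons xset gen_step_append_mid)
  next
    case 4
    then have k: "j \<in> {1..<length u}" using j i l by auto
    show thesis
      using 4 p l k gen_step_points[OF k p(1)]
      by (intro that[of "\<one>" "gen_step G X (j, e) u" z])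
        (auto simp: word_subst_Cons Transposition.transpose_def xset gen_step_append_left)
  qed
qed

text \<open>The block follows the strand that starts at \<open>i\<close> and so ends at
  \<open>word_perm w i\<close>; the group elements of successive crossings multiply, later ones on
  the left.\<close>

lemma word_subst_step:
  assumes "w \<in> bwords n" "i \<in> {1..n}"
    and "length u = i - 1" "length z = n - i"
    and "set u \<subseteq> points X" "set v \<subseteq> points X" "set z \<subseteq> points X"
  shows "\<exists>u' z' g. g \<in> carrier G \<and> set u' \<subseteq> points X \<and> set z' \<subseteq> points X \<and>
    length u' = word_perm w i - 1 \<and> length z' = n - word_perm w i \<and>
    word_step G X (word_subst w i (length v)) (u @ v @ z) = u' @ map (act X g) v @ z' \<and>
    (\<forall>a\<in>points X. val X a = tuple_val G X v \<longrightarrow>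
       word_step G X w (u @ [a] @ z) = u' @ [act X g a] @ z')"
  using assms
proof (induction w arbitrary: i u v z)
  case Nil
  then show ?case by (intro exI[of _ u] exI[of _ z] exI[of _ "\<one>"]) (auto simp: xset)
next
  case (Cons h w)
  obtain j e where h: "h = (j, e)" by force
  let ?i = "Transposition.transpose j (j + 1) i"
  have j: "j \<in> {1..<n}" and w: "w \<in> bwords n" using Cons.prems(1) by (auto simp: h)
  obtain u1 z1 g where 1: "g \<in> carrier G" "set u1 \<subseteq> points X" "set z1 \<subseteq> points X"
    "length u1 = ?i - 1" "length z1 = n - ?i"
    "word_step G X (word_subst [(j, e)] i (length v)) (u @ v @ z) = u1 @ map (act X g) v @ z1"
    and step1: "\<And>a. a \<in> points X \<Longrightarrow> val X a = tuple_val G X v \<Longrightarrow>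
       gen_step G X (j, e) (u @ [a] @ z) = u1 @ [act X g a] @ z1"
    by (rule gen_subst_step[OF j Cons.prems(2-7), of e]) (rule that)
  let ?v = "map (act X g) v"
  have v: "set ?v \<subseteq> points X" using map_act_points 1(1) Cons.prems by blast
  obtain u2 z2 k where 2: "k \<in> carrier G" "set u2 \<subseteq> points X" "set z2 \<subseteq> points X"
    "length u2 = word_perm w ?i - 1" "length z2 = n - word_perm w ?i"
    "word_step G X (word_subst w ?i (length ?v)) (u1 @ ?v @ z1) = u2 @ map (act X k) ?v @ z2"
    and step2: "\<And>a. a\<in>points X \<Longrightarrow> val X a = tuple_val G X ?v \<Longrightarrow>
       word_step G X w (u1 @ [a] @ z1) = u2 @ [act X k a] @ z2"
    using Cons.IH[OF w transpose_range[OF j Cons.prems(2)] 1(4,5,2) v 1(3)] by blast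
  have s: "word_subst (h # w) i (length v) = word_subst [(j, e)] i (length v) @ word_subst w ?i (length v)"
    unfolding h word_subst_Cons by simp
  have "word_step G X (word_subst (h # w) i (length v)) (u @ v @ z) = u2 @ map (act X (k \<otimes> g)) v @ z2"
    unfolding s steps_append[OF G X] 1(6) using 2(6) map_act_mult[OF 2(1) 1(1) Cons.prems(6)] by simp
  moreover have "word_step G X (h # w) (u @ [a] @ z) = u2 @ [act X (k \<otimes> g) a] @ z2"
    if a: "a \<in> points X" "val X a = tuple_val G X v" for a
  proof -
    \<comment> \<open>Both valuations are conjugated by the same \<open>g\<close>, so the moved
      entry and the moved block still agree and the induction hypothesis applies.\<close>
    have "val X (act X g a) = tuple_val G X ?v"
      using a 1(1) Cons.prems(6) by (simp add: xset tuple_val_map_act)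
    then show ?thesis using step1[OF a] step2[of "act X g a"] a 1(1) 2(1) by (simp add: h xset del: gen_step.simps)
  qed
  ultimately show ?case using 1(1) 2(1-5)
    by (intro exI[of _ u2] exI[of _ z2] exI[of _ "k \<otimes> g"]) (auto simp: h)
qed

text \<open>Naturality of the braiding in the morphism \<open>R\<close>: equality of valuations lets
  \<open>a\<close> stand in for \<open>v\<close> at every crossing, and equivariance transports the
  accumulated group element between them. The \<open>- 1\<close> converts strand numbers into
  positions for \<open>plug\<close>.\<close>

lemma word_rel_plug:
  assumes w: "w \<in> bwords n" and i: "i \<in> {1..n}"
    and R: "R \<subseteq> xpower X m \<times> points X"
    and val: "\<And>v a. (v, a) \<in> R \<Longrightarrow> tuple_val G X v = val X a"
    and act: "\<And>v a g. (v, a) \<in> R \<Longrightarrow> g \<in> carrier G \<Longrightarrow> (map (act X g) v, act X g a) \<in> R"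
    and S: "S \<subseteq> xpower X n \<times> Y"
  shows "word_rel G X (n + m - 1) (word_subst w i m) O plug (word_perm w i - 1) R S =
         plug (i - 1) R (word_rel G X n w O S)"
proof (intro equalityI subrelI)
  have i': "word_perm w i \<in> {1..n}" using word_perm_range w i by blast
  note rels = word_rel_steps[OF G X w] word_rel_steps[OF G X word_subst_bwords[OF w i]]
  {
    fix l b assume "(l, b) \<in> word_rel G X (n + m - 1) (word_subst w i m) O plug (word_perm w i - 1) R S"
    then obtain u1 v1 z1 a1 where l: "l \<in> xpower X (n + m - 1)"
      "word_step G X (word_subst w i m) l = u1 @ v1 @ z1" "length u1 = word_perm w i - 1"
      "(v1, a1) \<in> R" "(u1 @ [a1] @ z1, b) \<in> S"
      unfolding rels plug_def by blast
    define u v z where uvz_def: "u = take (i - 1) l" "v = take m (drop (i - 1) l)" "z = drop m (drop (i - 1) l)"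
    have uvz: "l = u @ v @ z" unfolding uvz_def append_take_drop_id ..
    have len: "length u = i - 1" "length v = m" "length z = n - i"
      using l(1) i by (auto simp: uvz_def xpower_def)
    have pts: "set u \<subseteq> points X" "set v \<subseteq> points X" "set z \<subseteq> points X"
      using l(1) by (auto simp: uvz xpower_def)
    obtain u' z' g where 1: "g \<in> carrier G" "length u' = word_perm w i - 1" "length z' = n - word_perm w i"
      "word_step G X (word_subst w i m) (u @ v @ z) = u' @ map (act X g) v @ z'"
      and 2: "\<And>a. a\<in>points X \<Longrightarrow> val X a = tuple_val G X v \<Longrightarrow>
         word_step G X w (u @ [a] @ z) = u' @ [act X g a] @ z'"
      using word_subst_step[OF w i len(1,3) pts] unfolding len(2) by blast
    have "length v1 = m" using R l(4) by (auto simp: xpower_def)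
    then have eq: "u1 = u'" "v1 = map (act X g) v" "z1 = z'"
      using l(2,3) 1(2,4) len(2) by (auto simp: uvz)
    \<comment> \<open>Only the value after the braid is given; undoing \<open>g\<close> yields the
      value before it, and \<open>R\<close> relates it to \<open>v\<close> by equivariance.\<close>
    let ?a = "act X (inv g) a1"
    have a1: "a1 \<in> points X" using R l(4) by auto
    have va: "(v, ?a) \<in> R" using act[OF l(4), of "inv g"] 1(1) map_act_inv[OF 1(1) pts(2)] by (simp add: eq)
    have a: "?a \<in> points X" using R va by auto
    have "act X g ?a = a1" using a1 1(1) by (simp add: xset)
    then have "word_step G X w (u @ [?a] @ z) = u1 @ [a1] @ z1"
      using 2[OF a] val[OF va] by (simp add: eq)
    moreover have "u @ [?a] @ z \<in> xpower X n" using a pts len i by (auto simp: xpower_def)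
    ultimately have "(u @ [?a] @ z, u1 @ [a1] @ z1) \<in> word_rel G X n w"
      unfolding rels by auto
    then have "(u @ [?a] @ z, b) \<in> word_rel G X n w O S" using l(5) by blast
    then show "(l, b) \<in> plug (i - 1) R (word_rel G X n w O S)"
      using va len(1) unfolding plug_def uvz by blast
  next
    fix l b assume "(l, b) \<in> plug (i - 1) R (word_rel G X n w O S)"
    then obtain u v z a where l: "l = u @ v @ z" "length u = i - 1" "(v, a) \<in> R"
      "u @ [a] @ z \<in> xpower X n" "(word_step G X w (u @ [a] @ z), b) \<in> S"
      unfolding rels plug_def by blast
    have v: "length v = m" "set v \<subseteq> points X" "a \<in> points X" using R l(3) by (auto simp: xpower_def)
    have len: "length z = n - i" using l(2,4) i by (auto simp: xpower_def)
    have pts: "set u \<subseteq> points X" "set z \<subseteq> points X" using l(4) by (auto simp: xpower_def)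
    obtain u' z' g where 1: "g \<in> carrier G" "length u' = word_perm w i - 1"
      "word_step G X (word_subst w i m) (u @ v @ z) = u' @ map (act X g) v @ z'"
      and 2: "word_step G X w (u @ [a] @ z) = u' @ [act X g a] @ z'"
      using word_subst_step[OF w i l(2) len pts(1) v(2) pts(2)] v(3) val[OF l(3)] unfolding v(1) by metis
    have "l \<in> xpower X (n + m - 1)" using l(1,2) len v pts i by (auto simp: xpower_def)
    then have "(l, u' @ map (act X g) v @ z') \<in> word_rel G X (n + m - 1) (word_subst w i m)"
      unfolding rels using 1(3) l(1) by auto
    moreover have "(u' @ map (act X g) v @ z', b) \<in> plug (word_perm w i - 1) R S"
      using act[OF l(3) 1(1)] l(5) 1(2) unfolding 2 plug_def by blast
    ultimately show "(l, b) \<in> word_rel G X (n + m - 1) (word_subst w i m) O plug (word_perm w i - 1) R S" by blast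
  }
qed

end

section \<open>A name-free interpretation of terms\<close>

text \<open>The interpretation only refers to positions in the context, never to names, so it can be
  computed from the raw term.\<close>

fun sem :: "('g, 'm) monoid_scheme \<Rightarrow> trm \<Rightarrow> ((bool list \<Rightarrow> 'g) list \<times> (bool list \<Rightarrow> 'g)) set" where
  "sem G (Atom _) = {([a], a) | a. a \<in> tree_set G}"
| "sem G (App M N) = {(u @ v, b) | u v b. \<exists>a. (u, tree_phi G b a) \<in> sem G M \<and> (v, a) \<in> sem G N}"
| "sem G (Lam M) = {(u, tree_phi G b a) | u a b. (u @ [a], b) \<in> sem G M}"
| "sem G (Braid s M) = braid_rel G (tree_xset G) (length (context_of M)) s O sem G M"

text \<open>What typability leaves on a raw term, stated so that it also holds for bodies of
  abstractions, whose contexts contain bound indices. The \<open>Lam\<close> clause puts the bound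
  variable last, as the rule for abstraction does.\<close>

fun well_scoped :: "trm \<Rightarrow> bool" where
  "well_scoped (Atom _) = True"
| "well_scoped (App M N) =
     (well_scoped M \<and> well_scoped N \<and> set (context_of M) \<inter> set (context_of N) = {})"
| "well_scoped (Lam M) =
     (well_scoped M \<and> (\<exists>K. context_of M = K @ [Bound 0] \<and> Bound 0 \<notin> set K))"
| "well_scoped (Braid s M) =
     (well_scoped M \<and> s \<in> carrier (braid_group (length (context_of M))))"

definition lower :: "atom \<Rightarrow> atom" where
  "lower a = (case a of Free x \<Rightarrow> Free x | Bound k \<Rightarrow> Bound (k - 1))"

lemma lower_eq_Free [simp]: "lower a = Free x \<longleftrightarrow> a = Free x" "Free x = lower a \<longleftrightarrow> a = Free x"
  by (cases a; auto simp: lower_def)+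

text \<open>The only two atoms that \<open>lower\<close> identifies are \<open>Bound 0\<close> and
  \<open>Bound 1\<close>, because of truncated subtraction.\<close>

lemma inj_on_lower: "Bound 0 \<notin> A \<Longrightarrow> inj_on lower A"
  by (auto simp: inj_on_def lower_def split: atom.splits) (metis Suc_pred neq0_conv)

lemma context_of_Lam: "context_of (Lam M) = map lower (filter (\<lambda>a. a \<noteq> Bound 0) (context_of M))"
  by (simp only: context_of.simps lower_def[abs_def])

lemma context_of_Lam_snoc:
  assumes "context_of M = K @ [Bound 0]" "Bound 0 \<notin> set K"
  shows "context_of (Lam M) = map lower K"
proof -
  have "filter (\<lambda>a. a \<noteq> Bound 0) K = K" using assms(2) by (intro filter_True) auto
  then show ?thesis by (simp add: context_of_Lam assms(1) del: context_of.simps)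
qed

text \<open>The indices \<open>braid_perm s i\<close> run through the positions exactly once.
  Multisets retain repetitions, so both distinctness and the number of strands survive the
  permutation.\<close>

lemma mset_braid_permute:
  assumes "s \<in> carrier (braid_group (length xs))"
  shows "mset (braid_permute s xs) = mset xs"
proof -
  have upt: "mset [1..<length xs + 1] = mset_set {1..length xs}"
    by (simp only: mset_upt atLeastLessThanSuc_atLeastAtMost Suc_eq_plus1[symmetric])
  have "mset (braid_permute s xs) = image_mset (\<lambda>i. xs ! (i - 1)) (image_mset (braid_perm s) (mset_set {1..length xs}))"
    by (simp only: braid_permute_def mset_map upt image_mset.compositionality o_def)
  also have "image_mset (braid_perm s) (mset_set {1..length xs}) = mset_set {1..length xs}"
    using carrier_perm[OF assms] by (simp add: bij_betw_def image_mset_mset_set)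
  also have "image_mset (\<lambda>i. xs ! (i - 1)) (mset_set {1..length xs}) = mset xs"
  proof -
    have "map (\<lambda>i. xs ! (i - 1)) [1..<length xs + 1] = xs"
      by (rule nth_equalityI) (simp_all del: upt_Suc)
    from arg_cong[OF this, of mset] show ?thesis unfolding mset_map upt .
  qed
  finally show ?thesis .
qed

lemma well_scoped_braids_ok: "well_scoped M \<Longrightarrow> braids_ok M"
  by (induction M) auto

lemma well_scoped_distinct: "well_scoped M \<Longrightarrow> distinct (context_of M)"
proof (induction M)
  case (Lam M)
  then obtain K where K: "context_of M = K @ [Bound 0]" "Bound 0 \<notin> set K" by auto
  then show ?case using Lam inj_on_lower[of "set K"] unfolding context_of_Lam_snoc[OF K]
    by (auto simp: distinct_map)
next
  case (Braid s M)
  then show ?case using mset_braid_permute[of s "context_of M"] by (auto dest: mset_eq_imp_distinct_iff)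
qed auto

text \<open>With \<open>Bound k\<close> absent, turning \<open>Free x\<close> into
  \<open>Bound k\<close> merges no atoms, so disjointness of contexts is kept.\<close>

lemma well_scoped_bind_var:
  "well_scoped M \<Longrightarrow> Bound k \<notin> set (context_of M) \<Longrightarrow> well_scoped (bind_var k x M)"
proof (induction M arbitrary: k)
  case (App M N)
  then show ?case using braids_ok_bind[of M k x] braids_ok_bind[of N k x]
    by (auto simp: well_scoped_braids_ok)
next
  case (Lam M)
  have k: "Bound (Suc k) \<notin> set (context_of M)"
    using Lam.prems by (force simp: image_iff split: atom.splits)
  then show ?case using Lam braids_ok_bind[of M "Suc k" x]
    by (auto simp: well_scoped_braids_ok)
next
  case (Braid s M)
  then show ?case using braids_ok_bind[of M k x]
    by (auto simp: well_scoped_braids_ok set_braid_permute)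
qed auto

text \<open>\<open>sem\<close> consults a context only for its length, in the braid clause, and
  renaming an atom preserves lengths.\<close>

lemma sem_bind_var:
  "well_scoped M \<Longrightarrow> Bound k \<notin> set (context_of M) \<Longrightarrow> sem G (bind_var k x M) = sem G M"
proof (induction M arbitrary: k)
  case (Lam M)
  have k: "Bound (Suc k) \<notin> set (context_of M)"
    using Lam.prems by (force simp: image_iff split: atom.splits)
  then show ?case using Lam by simp
next
  case (Braid s M)
  then show ?case using braids_ok_bind[of M k x]
    by (auto simp: well_scoped_braids_ok set_braid_permute)
qed auto

lemma judgement_well_scoped: "\<Gamma> \<turnstile> M \<Longrightarrow> well_scoped M"
proof (induction rule: judgement.induct)
  case (lam \<Gamma> x M)
  have c: "context_of M = map Free \<Gamma> @ [Free x]" "distinct (\<Gamma> @ [x])" "braids_ok M"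
    using judgement_context_ok[OF lam.hyps] by auto
  then have "Bound 0 \<notin> set (context_of M)" by auto
  then have "context_of (bind_var 0 x M) = map Free \<Gamma> @ [Bound 0]"
    using braids_ok_bind[of M 0 x] c by auto
  then show ?case using lam.IH c well_scoped_bind_var[of M 0 x] by (auto simp: lam_def)
qed (auto simp: judgement_context)

lemma sem_lam:
  assumes "\<Gamma> \<turnstile> M"
  shows "sem G (lam x M) = {(u, tree_phi G b a) | u a b. (u @ [a], b) \<in> sem G M}"
  using sem_bind_var[OF judgement_well_scoped[OF assms], of 0 G x] judgement_context[OF assms]
  by (auto simp: lam_def)

section \<open>Existence and uniqueness of denotations\<close>

text \<open>Two derivations for one abstraction may use different bound names and hence different
  bodies. Comparing each with \<open>sem\<close> gives uniqueness without comparing them with each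
  other.\<close>

lemma denotes_sem: "denotes G \<Gamma> M R \<Longrightarrow> \<Gamma> \<turnstile> M \<and> R = sem G M"
proof (induction rule: denotes.induct)
  case (lam \<Gamma> x M R)
  then show ?case by (auto simp: sem_lam intro: judgement.lam)
next
  case (var x)
  show ?case using judgement.var by simp
next
  case (app \<Gamma> M R \<Delta> N S)
  then show ?case using judgement.app by simp
next
  case (braid \<Gamma> M R s)
  then show ?case using judgement.braid judgement_context[of \<Gamma> M] by simp
qed

lemma judgement_denotes: "\<Gamma> \<turnstile> M \<Longrightarrow> denotes G \<Gamma> M (sem G M)"
proof (induction rule: judgement.induct)
  case (lam \<Gamma> x M)
  from denotes.lam[OF lam.IH] show ?case unfolding sem_lam[OF lam.hyps] .
next
  case (app \<Gamma> M \<Delta> N)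
  from denotes.app[OF app.IH app.hyps(3)] show ?case by simp
next
  case (braid \<Gamma> M s)
  from denotes.braid[OF braid.IH braid.hyps(2)] show ?case
    by (simp add: judgement_context[OF braid.hyps(1)])
next
  case (var x)
  from denotes.var[of G x] show ?case by simp
qed

lemma denotes_unique: "\<Gamma> \<turnstile> M \<Longrightarrow> \<exists>!R. denotes G \<Gamma> M R"
  by (rule ex1I[of _ "sem G M"]) (simp_all add: judgement_denotes denotes_sem)

lemma interp_sem: "\<Gamma> \<turnstile> M \<Longrightarrow> interp G \<Gamma> M = sem G M"
  unfolding interp_def by (rule the_equality) (simp_all add: judgement_denotes denotes_sem)

section \<open>Soundness\<close>

lemma plug_Lam:
  assumes "\<And>u b. (u, b) \<in> S \<Longrightarrow> length u = Suc n" "k < n"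
  shows "{(u, f b c) | u c b. (u @ [c], b) \<in> plug k R S} = plug k R {(u, f b c) | u c b. (u @ [c], b) \<in> S}"
proof (intro equalityI subrelI)
  fix l d assume "(l, d) \<in> {(u, f b c) | u c b. (u @ [c], b) \<in> plug k R S}"
  then obtain u v z a b c where *: "l @ [c] = u @ v @ z" "d = f b c" "length u = k" "(v, a) \<in> R" "(u @ [a] @ z, b) \<in> S"
    unfolding plug_def by blast
  \<comment> \<open>As \<open>k < n\<close>, the plugged entry is not the last one; the abstracted
    entry \<open>c\<close> therefore ends \<open>z\<close> rather than \<open>v\<close>.\<close>
  have "z \<noteq> []" using assms *(3) assms(1)[OF *(5)] by auto
  then obtain z' where "z = z' @ [c]" using *(1) by (cases z rule: rev_cases) auto
  then show "(l, d) \<in> plug k R {(u, f b c) | u c b. (u @ [c], b) \<in> S}"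
    using * unfolding plug_def by fastforce
next
  fix l d assume "(l, d) \<in> plug k R {(u, f b c) | u c b. (u @ [c], b) \<in> S}"
  then obtain u v z a b c where *: "l = u @ v @ z" "d = f b c" "length u = k" "(v, a) \<in> R" "((u @ [a] @ z) @ [c], b) \<in> S"
    unfolding plug_def by blast
  then have "(l @ [c], b) \<in> plug k R S" unfolding plug_def by fastforce
  then show "(l, d) \<in> {(u, f b c) | u c b. (u @ [c], b) \<in> plug k R S}" using * by blast
qed

text \<open>The application clause of \<open>sem\<close> with \<open>tree_phi G\<close> made a
  parameter: its interaction with \<open>plug\<close> is pure list splitting.\<close>

definition apply_rel :: "('b \<Rightarrow> 'a \<Rightarrow> 'c) \<Rightarrow> ('x list \<times> 'c) set \<Rightarrow> ('x list \<times> 'a) set \<Rightarrow> ('x list \<times> 'b) set" where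
  "apply_rel f S T = {(u @ v, b) | u v b. \<exists>a. (u, f b a) \<in> S \<and> (v, a) \<in> T}"

lemma plug_App_left:
  assumes "\<And>u b. (u, b) \<in> S \<Longrightarrow> length u = n" "k < n"
  shows "apply_rel f (plug k R S) T = plug k R (apply_rel f S T)"
proof (intro equalityI subrelI)
  fix l b assume "(l, b) \<in> apply_rel f (plug k R S) T"
  then obtain u v z y a c where *: "l = (u @ v @ z) @ y" "length u = k" "(v, c) \<in> R" "(u @ [c] @ z, f b a) \<in> S" "(y, a) \<in> T"
    unfolding plug_def apply_rel_def by blast
  then have "((u @ [c] @ z) @ y, b) \<in> apply_rel f S T" unfolding apply_rel_def by blast
  then show "(l, b) \<in> plug k R (apply_rel f S T)" using *(1-3) unfolding plug_def by fastforce
next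
  fix l b assume "(l, b) \<in> plug k R (apply_rel f S T)"
  then obtain u v z y a c x where *: "l = u @ v @ z" "length u = k" "(v, c) \<in> R" "u @ [c] @ z = x @ y"
      "(x, f b a) \<in> S" "(y, a) \<in> T"
    unfolding plug_def apply_rel_def by blast
  have "length x = n" using assms(1) *(5) by blast
  \<comment> \<open>The two splittings of one list are compared: since \<open>k < n\<close>, the
    entry \<open>[c]\<close> falls into the function part \<open>x\<close>.\<close>
  then obtain x' where x: "x = u @ x'" "[c] @ z = x' @ y" "x' \<noteq> []"
    using *(2,4) assms(2) by (auto simp: append_eq_append_conv2)
  then obtain z' where z: "x' = [c] @ z'" "z = z' @ y" by (cases x') auto
  have "(u @ v @ z', f b a) \<in> plug k R S"
    using *(2,3,5) unfolding x(1) z(1) plug_def by blast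
  then have "((u @ v @ z') @ y, b) \<in> apply_rel f (plug k R S) T"
    using *(6) unfolding apply_rel_def by blast
  then show "(l, b) \<in> apply_rel f (plug k R S) T" by (simp add: *(1) z(2))
qed

lemma plug_App_right:
  assumes "\<And>u b. (u, b) \<in> S \<Longrightarrow> length u = n"
  shows "apply_rel f S (plug k R T) = plug (n + k) R (apply_rel f S T)"
proof (intro equalityI subrelI)
  fix l b assume "(l, b) \<in> apply_rel f S (plug k R T)"
  then obtain u v z y a c where *: "l = y @ (u @ v @ z)" "length u = k" "(v, c) \<in> R" "(u @ [c] @ z, a) \<in> T" "(y, f b a) \<in> S"
    unfolding plug_def apply_rel_def by blast
  then have "((y @ u) @ [c] @ z, b) \<in> apply_rel f S T" unfolding apply_rel_def by force
  then show "(l, b) \<in> plug (n + k) R (apply_rel f S T)"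
    using *(1-3) assms[OF *(5)] unfolding plug_def
    by (intro CollectI) (rule exI[of _ "y @ u"], fastforce)
next
  fix l b assume "(l, b) \<in> plug (n + k) R (apply_rel f S T)"
  then obtain u v z y a c x where *: "l = u @ v @ z" "length u = n + k" "(v, c) \<in> R" "u @ [c] @ z = x @ y"
      "(x, f b a) \<in> S" "(y, a) \<in> T"
    unfolding plug_def apply_rel_def by blast
  have "length x = n" using assms *(5) by blast
  then have "u = x @ drop n u" "y = drop n u @ [c] @ z"
    using *(2,4) by (auto simp: append_eq_append_conv2 append_eq_Cons_conv)
  then have "(drop n u @ v @ z, a) \<in> plug k R T"
    using *(2,3,6) unfolding plug_def by force
  then show "(l, b) \<in> apply_rel f S (plug k R T)"
    using *(1,5) \<open>u = _\<close> unfolding apply_rel_def by (metis (mono_tags, lifting) append.assoc mem_Collect_eq)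
qed

section \<open>Denotations as morphisms, and the substitution lemma\<close>

context
  fixes G :: "('g, 'm) monoid_scheme" (structure)
  assumes G: "group G"
begin

interpretation group G by (rule G)

abbreviation (input) D :: "('g, bool list \<Rightarrow> 'g) xset" where "D \<equiv> tree_xset G"

lemmas D = crossed_tree_xset[OF G]

text \<open>For application the valuations multiply to |b||a|^{-1}|a| = |b|; for abstraction |u||a|
  = |c| is solved for |u|, giving the root entry of \<open>tree_phi G c a\<close>. Equivariance
  passes through both by \<open>act_tree_phi\<close>, and through braids by
  \<open>word_step_props\<close>.\<close>

lemma sem_typed:
  assumes "well_scoped M" "(u, b) \<in> sem G M"
  shows "u \<in> xpower D (length (context_of M)) \<and> b \<in> tree_set G \<and> tuple_val G D u = b [] \<and>
    (\<forall>g\<in>carrier G. (map (act D g) u, act D g b) \<in> sem G M)"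
  using assms
proof (induction M arbitrary: u b)
  case (Atom a)
  then show ?case using xset_simps(2)[OF D G] by (auto simp: xpower_def tree_setD(1))
next
  case (App M N)
  then obtain v w a where *: "u = v @ w" "(v, tree_phi G b a) \<in> sem G M" "(w, a) \<in> sem G N" by auto
  have v: "v \<in> xpower D (length (context_of M))" "b \<in> tree_set G" "a \<in> tree_set G"
     "tuple_val G D v = b [] \<otimes> inv (a [])"
     "g \<in> carrier G \<Longrightarrow> (map (act D g) v, tree_phi G (act D g b) (act D g a)) \<in> sem G M" for g
    using App.IH(1)[OF _ *(2)] App.prems(1) by (auto simp: G act_tree_phi)
  have w: "w \<in> xpower D (length (context_of N))" "tuple_val G D w = a []"
     "g \<in> carrier G \<Longrightarrow> (map (act D g) w, act D g a) \<in> sem G N" for g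
    using App.IH(2)[OF _ *(3)] App.prems(1) by (auto)
  have "tuple_val G D u = b []"
    using v w tree_setD(1)[OF v(2)] tree_setD(1)[OF v(3)] unfolding *(1)
    by (subst tuple_val_append[OF G D]) (auto simp: xpower_def m_assoc)
  moreover have "(map (act D g) u, act D g b) \<in> sem G (App M N)" if "g \<in> carrier G" for g
    using v(5)[OF that] w(3)[OF that] unfolding *(1) by (auto)
  ultimately show ?case using v(1,2) w(1) by (auto simp: *(1) xpower_def)
next
  case (Lam M)
  then obtain K where K: "context_of M = K @ [Bound 0]" "Bound 0 \<notin> set K" "well_scoped M" by auto
  from Lam.prems obtain c a where *: "b = tree_phi G c a" "(u @ [a], c) \<in> sem G M" by auto
  note IH = Lam.IH[OF K(3) *(2)]
  have u: "set u \<subseteq> points D" "length u = length K" "a \<in> tree_set G" "c \<in> tree_set G"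
    using IH by (auto simp: xpower_def K(1))
  have "tuple_val G D u \<otimes> a [] = c []"
    using IH u tree_setD(1)[OF u(3)] by (simp add: tuple_val_append[OF G D])
  then have "tuple_val G D u = b []"
    using u tree_setD(1)[OF u(3)] tuple_val_closed[OF G D u(1)] tree_setD(1)[OF u(4)]
    by (simp add: *(1) inv_solve_right)
  moreover have "(map (act D g) u, act D g b) \<in> sem G (Lam M)" if g: "g \<in> carrier G" for g
    using IH g u act_tree_phi[OF G g u(4,3)] by (auto simp: *(1))
  ultimately show ?case using u context_of_Lam_snoc[OF K(1,2)]
    by (simp add: *(1) xpower_def G del: context_of.simps sem.simps)
next
  case (Braid s M)
  let ?n = "length (context_of M)"
  obtain w where w: "w \<in> bwords ?n" "s = braid_class ?n w"
    using Braid.prems(1) by (auto simp: braid_group_carrier)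
  have sem: "sem G (Braid s M) = {(u, word_step G D w u) | u. u \<in> xpower D ?n} O sem G M"
    by (simp add: w(2) braid_rel_class[OF G D w(1)] word_rel_steps[OF G D w(1)])
  then have u: "u \<in> xpower D ?n" "(word_step G D w u, b) \<in> sem G M" using Braid.prems(2) by auto
  have u': "w \<in> bwords (length u)" "set u \<subseteq> points D" using u(1) w(1) by (auto simp: xpower_def)
  note IH = Braid.IH[OF _ u(2)] and ws = word_step_props[OF G D u']
  have "(map (act D g) u, act D g b) \<in> sem G (Braid s M)" if g: "g \<in> carrier G" for g
  proof -
    have "map (act D g) u \<in> xpower D ?n"
      using map_act_points[OF G D g u'(2)] u(1) by (auto simp: xpower_def)
    moreover have "(word_step G D w (map (act D g) u), act D g b) \<in> sem G M"
      unfolding ws(4)[OF g] using IH g Braid.prems(1) by simp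
    ultimately show ?thesis unfolding sem by blast
  qed
  then show ?case using IH u(1) ws(3) Braid.prems(1) by simp
qed

lemma sem_subset: "well_scoped M \<Longrightarrow> sem G M \<subseteq> xpower D (length (context_of M)) \<times> tree_set G"
  by (rule subrelI) (simp add: sem_typed)

lemma sem_length: "well_scoped M \<Longrightarrow> (u, b) \<in> sem G M \<Longrightarrow> length u = length (context_of M)"
  using sem_typed by (auto simp: xpower_def)

lemma sem_App: "sem G (App M N) = apply_rel (tree_phi G) (sem G M) (sem G N)"
  by (simp add: apply_rel_def)

text \<open>The multiset equation is carried along because the braid case must know the number of
  strands of \<open>subst M x N\<close>; a size alone would not survive the \<open>Lam\<close> case,
  where the occurrences of \<open>Bound 0\<close> are removed. Leaving the order open avoids
  computing the permutation of a cabled braid.\<close>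

lemma sem_subst:
  assumes N: "well_scoped N" "context_of N = map Free \<Delta>"
    and "well_scoped M" "k < length (context_of M)" "context_of M ! k = Free x"
  shows "add_mset (Free x) (mset (context_of (subst M x N))) = mset (context_of M) + mset (context_of N) \<and>
    sem G (subst M x N) = plug k (sem G N) (sem G M)"
  using assms(3-5)
proof (induction M arbitrary: k)
  case (Atom a)
  then show ?case using sem_subset[OF N(1)] by (fastforce simp: plug_def)
next
  case (App M M')
  let ?n = "length (context_of M)"
  have ok: "well_scoped M" "well_scoped M'" "braids_ok M" "braids_ok M'"
    using App.prems well_scoped_braids_ok by auto
  show ?case
  proof (cases "k < ?n")
    case True
    then have x: "context_of M ! k = Free x" using App.prems by (simp add: nth_append)
    then have "Free x \<notin> set (context_of M')" using App.prems(1) True nth_mem by fastforce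
    \<comment> \<open>The contexts of the two parts are disjoint, so the substitution happens on one
      side only.\<close>
    then have M': "subst M' x N = M'" using subst_fresh ok by blast
    show ?thesis using App.IH(1)[OF ok(1) True x] plug_App_left[of "sem G M", OF sem_length[OF ok(1)] True]
      unfolding subst.simps M' sem_App by simp
  next
    case False
    then obtain l where l: "k = ?n + l" using le_Suc_ex by force
    have lt: "l < length (context_of M')" and x: "context_of M' ! l = Free x"
      using App.prems by (auto simp: l nth_append)
    then have "Free x \<notin> set (context_of M)" using App.prems(1) nth_mem by fastforce
    then have M: "subst M x N = M" using subst_fresh ok by blast
    show ?thesis using App.IH(2)[OF ok(2) lt x] plug_App_right[of "sem G M", OF sem_length[OF ok(1)]]
      unfolding subst.simps M sem_App l by simp
  qed
next
  case (Lam M)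
  then obtain K where K: "context_of M = K @ [Bound 0]" "Bound 0 \<notin> set K" "well_scoped M" by auto
  have k: "k < length K" "context_of M ! k = Free x" "k < length (context_of M)"
    using Lam.prems unfolding context_of_Lam_snoc[OF K(1,2)] by (auto simp: K(1) nth_append)
  note IH = Lam.IH[OF K(3) k(3,2)]
  have "image_mset lower (filter_mset (\<lambda>a. a \<noteq> Bound 0) (add_mset (Free x) (mset (context_of (subst M x N))))) =
     image_mset lower (filter_mset (\<lambda>a. a \<noteq> Bound 0) (mset (context_of M) + mset (context_of N)))"
    using IH by simp
  \<comment> \<open>The context of \<open>N\<close> consists of free names, so leaving the binder
    neither removes nor changes any of them.\<close>
  moreover have "map lower (filter (\<lambda>a. a \<noteq> Bound 0) (map Free \<Delta>)) = map Free \<Delta>"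
    by (induction \<Delta>) (auto simp: lower_def)
  ultimately have "add_mset (Free x) (mset (context_of (subst (Lam M) x N))) = mset (context_of (Lam M)) + mset (context_of N)"
    unfolding context_of_Lam subst.simps N(2) by (simp add: lower_def o_def flip: mset_filter mset_map)
  moreover have "length u = Suc (length K)" if "(u, b) \<in> sem G M" for u b
    using sem_length[OF K(3) that] K(1) by simp
  ultimately show ?case using IH plug_Lam[of "sem G M" "length K" k "tree_phi G" "sem G N"] k(1) by simp
next
  case (Braid s M)
  let ?c = "context_of M" and ?m = "length (context_of N)"
  let ?n = "length ?c"
  have ok: "well_scoped M" and k: "k < ?n" using Braid.prems by auto
  obtain w where w: "w \<in> bwords ?n" "s = braid_class ?n w"
    using Braid.prems(1) by (auto simp: braid_group_carrier)
  \<comment> \<open>The strand of \<open>x\<close> enters the braid at \<open>k + 1\<close> and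
    leaves it at \<open>i\<close>, the place of \<open>x\<close> in the context of the body. Hence
    the preimage of \<open>i\<close> demanded by \<open>subst\<close> is
    \<open>k + 1\<close>.\<close>
  define i where "i = word_perm w (k + 1)"
  have k1: "k + 1 \<in> {1..?n}" using k by simp
  have i: "i \<in> {1..?n}" unfolding i_def using word_perm_range[OF w(1) k1] .
  have x: "?c ! (i - 1) = Free x"
    using Braid.prems(3) k by (simp add: braid_permute_def w(2) braid_perm_class[OF w(1)] i_def del: upt_Suc)
  have i1: "i - 1 < ?n" using i by auto
  note IH = Braid.IH[OF ok i1 x]
  have "takeWhile (\<lambda>a. a \<noteq> Free x) ?c = take (i - 1) ?c"
    using well_scoped_distinct[OF ok] x i1 by (intro takeWhile_eq_take_P_nth) (auto simp: nth_eq_iff_index_eq simp flip: x)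
  then have t: "length (takeWhile (\<lambda>a. a \<noteq> Free x) ?c) + 1 = i" using i by auto
  have inv: "inv_into {1..?n} (braid_perm s) i = k + 1"
    using bij_word_perm[OF w(1)] k1 by (simp add: w(2) braid_perm_class[OF w(1)] i_def bij_betw_def)
  have mem: "Free x \<in> set ?c" using x i1 nth_mem by metis
  let ?w = "word_subst w (k + 1) ?m"
  have sub: "subst (Braid s M) x N = Braid (braid_class (?n + ?m - 1) ?w) (subst M x N)"
    unfolding subst.simps if_P[OF mem] Let_def t inv
    using braid_subst_class[OF w(1) k1, of ?m] by (simp add: w(2))
  have w': "?w \<in> bwords (?n + ?m - 1)" using word_subst_bwords[OF w(1) k1] .
  have len: "length (context_of (subst M x N)) = ?n + ?m - 1"
    using arg_cong[OF conjunct1[OF IH], of size] by simp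
  have "mset (context_of (subst (Braid s M) x N)) = mset (context_of (subst M x N))"
    unfolding sub context_of.simps using w' by (intro mset_braid_permute) (auto simp: len braid_group_carrier)
  moreover have "mset (context_of (Braid s M)) = mset ?c"
    unfolding context_of.simps using w by (intro mset_braid_permute) (auto simp: braid_group_carrier)
  moreover have "word_rel G D (?n + ?m - 1) ?w O plug (i - 1) (sem G N) (sem G M) =
      plug k (sem G N) (word_rel G D ?n w O sem G M)"
    using word_rel_plug[OF G D w(1) k1 _ _ _ sem_subset[OF ok], of "sem G N" ?m] sem_typed[OF N(1)]
    unfolding i_def by fastforce
  ultimately show ?case using IH
    unfolding sub sem.simps len braid_rel_class[OF G D w'] unfolding w(2) braid_rel_class[OF G D w(1)]
    by simp
qed

section \<open>Soundness of the beta and eta equations\<close>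

text \<open>Injectivity of \<phi> lets the application clause read off exactly the pair put in by
  abstraction. On the other side \<open>x\<close> is last in its context, so plugging at
  \<open>length \<Gamma>\<close> leaves nothing to the right.\<close>

lemma sem_App_lam:
  assumes "\<Gamma> @ [x] \<turnstile> M" "\<Delta> \<turnstile> N"
  shows "sem G (App (lam x M) N) = sem G (subst M x N)"
proof -
  have M: "well_scoped M" "context_of M = map Free \<Gamma> @ [Free x]"
    using assms(1) judgement_well_scoped judgement_context by force+
  have N: "well_scoped N" "context_of N = map Free \<Delta>"
    using assms(2) judgement_well_scoped judgement_context by force+
  have "sem G (subst M x N) = plug (length \<Gamma>) (sem G N) (sem G M)"
    using sem_subst[OF N M(1), of "length \<Gamma>" x] M(2) by (simp add: nth_append)
  also have "\<dots> = {(u @ v, b) | u v b. \<exists>a. (v, a) \<in> sem G N \<and> (u @ [a], b) \<in> sem G M}"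
  proof (intro equalityI subrelI)
    fix l b assume "(l, b) \<in> plug (length \<Gamma>) (sem G N) (sem G M)"
    then obtain u v z a where *: "l = u @ v @ z" "length u = length \<Gamma>" "(v, a) \<in> sem G N"
      "(u @ [a] @ z, b) \<in> sem G M"
      unfolding plug_def by blast
    then have "z = []" using sem_length[OF M(1) *(4)] M(2) by simp
    with * show "(l, b) \<in> {(u @ v, b) | u v b. \<exists>a. (v, a) \<in> sem G N \<and> (u @ [a], b) \<in> sem G M}"
      by auto
  next
    fix l b assume "(l, b) \<in> {(u @ v, b) | u v b. \<exists>a. (v, a) \<in> sem G N \<and> (u @ [a], b) \<in> sem G M}"
    then obtain u v a where *: "l = u @ v @ []" "(v, a) \<in> sem G N" "(u @ [a] @ [], b) \<in> sem G M"
      by auto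
    then have "length u = length \<Gamma>" using sem_length[OF M(1) *(3)] M(2) by simp
    with * show "(l, b) \<in> plug (length \<Gamma>) (sem G N) (sem G M)" unfolding plug_def by blast
  qed
  also have "\<dots> = sem G (App (lam x M) N)"
    by (auto simp: sem_lam[OF assms(1)])
  finally show ?thesis by simp
qed

lemma sem_eta:
  assumes "\<Gamma> \<turnstile> M" "x \<notin> set \<Gamma>"
  shows "sem G (lam x (App M (Var x))) = sem G M"
proof -
  have "\<Gamma> @ [x] \<turnstile> App M (Var x)" using assms judgement.app[OF _ judgement.var] by simp
  note lam = sem_lam[OF this, of G]
  have "(u @ [a], b) \<in> sem G (App M (Var x)) \<longleftrightarrow> (u, tree_phi G b a) \<in> sem G M \<and> a \<in> tree_set G"
    for u a b by auto
  then have "sem G (lam x (App M (Var x))) =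
      {(u, tree_phi G b a) | u a b. (u, tree_phi G b a) \<in> sem G M \<and> a \<in> tree_set G}"
    unfolding lam by simp
  also have "\<dots> = sem G M"
  proof (intro equalityI subrelI)
    fix u c assume c: "(u, c) \<in> sem G M"
    then have "c \<in> tree_set G" using sem_subset[OF judgement_well_scoped[OF assms(1)]] by blast
    \<comment> \<open>Surjectivity of \<phi>: \<open>b\<close> is the child at 0 and
      \<open>a\<close> the child at 1.\<close>
    then obtain a b where "c = tree_phi G b a" "a \<in> tree_set G"
      using tree_phi_children children_in_tree_set by metis
    with c show "(u, c) \<in> {(u, tree_phi G b a) | u a b. (u, tree_phi G b a) \<in> sem G M \<and> a \<in> tree_set G}"
      by blast
  qed auto
  finally show ?thesis .
qed

section \<open>Soundness of the braid equations\<close>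

text \<open>Turns each equation between braided terms into one about the function
  \<open>word_step\<close> of a chosen representative.\<close>

lemma sem_braid_class:
  assumes "w \<in> bwords (length (context_of M))"
  shows "sem G (Braid (braid_class (length (context_of M)) w) M) =
    {(u, b). u \<in> xpower D (length (context_of M)) \<and> (word_step G D w u, b) \<in> sem G M}"
  using assms by (auto simp: braid_rel_class[OF G D] word_rel_steps[OF G D])

lemma sem_braid_mult:
  assumes "s \<in> carrier (braid_group (length (context_of M)))" "s' \<in> carrier (braid_group (length (context_of M)))"
  shows "sem G (Braid s (Braid s' M)) = sem G (Braid (s \<otimes>\<^bsub>braid_group (length (context_of M))\<^esub> s') M)"
proof -
  let ?n = "length (context_of M)"
  obtain w w' where w: "w \<in> bwords ?n" "s = braid_class ?n w" "w' \<in> bwords ?n" "s' = braid_class ?n w'"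
    using assms by (auto simp: braid_group_carrier)
  have len: "length (context_of (Braid s' M)) = ?n" by simp
  show ?thesis
    using sem_braid_class[of w "Braid s' M"] sem_braid_class[of w' M] sem_braid_class[of "w @ w'" M] w
      steps_xpower[OF G D w(1)] steps_append[OF G D, of w w']
    unfolding len by (auto simp: braid_group_mult simp del: sem.simps)
qed

lemma sem_braid_App:
  assumes "well_scoped M" "well_scoped N"
    and "s \<in> carrier (braid_group (length (context_of M)))" "s' \<in> carrier (braid_group (length (context_of N)))"
  shows "sem G (App (Braid s M) (Braid s' N)) =
    sem G (Braid (braid_tensor (length (context_of M)) (length (context_of N)) s s') (App M N))"
proof -
  let ?n = "length (context_of M)" and ?m = "length (context_of N)"
  obtain w w' where w: "w \<in> bwords ?n" "s = braid_class ?n w" "w' \<in> bwords ?m" "s' = braid_class ?m w'"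
    using assms by (auto simp: braid_group_carrier)
  let ?w = "map (\<lambda>(j, e). (?n + j, e)) w'"
  have len: "length (context_of (App M N)) = ?n + ?m" by simp
  have wb: "w @ ?w \<in> bwords (?n + ?m)"
  proof -
    have "w \<in> bwords (?n + ?m)" using w(1) by (induction w) auto
    moreover have "?w \<in> bwords (?n + ?m)" using w(3) by (induction w') auto
    ultimately show ?thesis by simp
  qed
  have step: "word_step G D (w @ ?w) (u @ v) = word_step G D w u @ word_step G D w' v"
    if "u \<in> xpower D ?n" for u v
  proof -
    have u: "w \<in> bwords (length u)" "set u \<subseteq> points D" "length u = ?n" using that w(1) by (auto simp: xpower_def)
    show ?thesis using word_step_props(2,5)[OF G D u(1,2)] u(3) w(3)
      by (simp add: steps_append[OF G D] word_step_shift[OF G D])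
  qed
  have "sem G (Braid (braid_tensor ?n ?m s s') (App M N)) =
      {(u, b). u \<in> xpower D (?n + ?m) \<and> (word_step G D (w @ ?w) u, b) \<in> sem G (App M N)}"
    using sem_braid_class[of "w @ ?w" "App M N"] wb unfolding len w(2,4) braid_tensor_class[OF w(1,3)] by simp
  also have "\<dots> = {(u @ v, b) | u v b. u \<in> xpower D ?n \<and> v \<in> xpower D ?m \<and>
      (\<exists>a. (word_step G D w u, tree_phi G b a) \<in> sem G M \<and> (word_step G D w' v, a) \<in> sem G N)}"
  proof (intro equalityI subrelI)
    fix l b assume "(l, b) \<in> {(u, b). u \<in> xpower D (?n + ?m) \<and> (word_step G D (w @ ?w) u, b) \<in> sem G (App M N)}"
    then have l: "l \<in> xpower D (?n + ?m)" "(word_step G D (w @ ?w) l, b) \<in> sem G (App M N)" by auto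
    define u v where uv: "u = take ?n l" "v = drop ?n l"
    have l': "l = u @ v" "u \<in> xpower D ?n" "v \<in> xpower D ?m"
      using l(1) by (auto simp: uv xpower_def dest: in_set_takeD in_set_dropD)
    obtain x y a where xy: "word_step G D w u @ word_step G D w' v = x @ y"
      "(x, tree_phi G b a) \<in> sem G M" "(y, a) \<in> sem G N"
      using l(2) step[OF l'(2), of v] by (auto simp: l'(1))
    \<comment> \<open>The application clause splits the tuple at an unspecified place; typing of
      \<open>M\<close> forces this place to be where the two braids meet.\<close>
    have "length x = ?n" using sem_length[OF assms(1) xy(2)] .
    moreover have "length (word_step G D w u) = ?n"
      using steps_xpower[OF G D w(1) l'(2)] by (simp add: xpower_def)
    ultimately have "word_step G D w u = x" "word_step G D w' v = y" using xy(1) by auto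
    then show "(l, b) \<in> {(u @ v, b) | u v b. u \<in> xpower D ?n \<and> v \<in> xpower D ?m \<and>
      (\<exists>a. (word_step G D w u, tree_phi G b a) \<in> sem G M \<and> (word_step G D w' v, a) \<in> sem G N)}"
      using l' xy by blast
  next
    fix l b assume "(l, b) \<in> {(u @ v, b) | u v b. u \<in> xpower D ?n \<and> v \<in> xpower D ?m \<and>
      (\<exists>a. (word_step G D w u, tree_phi G b a) \<in> sem G M \<and> (word_step G D w' v, a) \<in> sem G N)}"
    then obtain u v a where *: "l = u @ v" "u \<in> xpower D ?n" "v \<in> xpower D ?m"
      "(word_step G D w u, tree_phi G b a) \<in> sem G M" "(word_step G D w' v, a) \<in> sem G N" by blast
    then show "(l, b) \<in> {(u, b). u \<in> xpower D (?n + ?m) \<and> (word_step G D (w @ ?w) u, b) \<in> sem G (App M N)}"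
      using step[OF *(2), of v] by (auto simp: xpower_def simp del: map_append)
  qed
  also have "\<dots> = sem G (App (Braid s M) (Braid s' N))"
    unfolding sem.simps(2) using sem_braid_class[OF w(1)] sem_braid_class[OF w(3)] unfolding w(2,4)[symmetric] by auto
  finally show ?thesis by simp
qed

lemma sem_braid_lam:
  assumes "\<Gamma> @ [x] \<turnstile> M" and s: "s \<in> carrier (braid_group (length \<Gamma>))"
  shows "sem G (Braid s (lam x M)) =
    sem G (lam x (Braid (braid_tensor (length \<Gamma>) 1 s \<one>\<^bsub>braid_group 1\<^esub>) M))"
proof -
  let ?n = "length \<Gamma>"
  obtain w where w: "w \<in> bwords ?n" "s = braid_class ?n w"
    using s by (auto simp: braid_group_carrier)
  have wb: "w \<in> bwords (?n + 1)" using w(1) by (induction w) auto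
  have M: "well_scoped M" "length (context_of M) = ?n + 1"
    using assms(1) judgement_well_scoped judgement_context by force+
  have lM: "length (context_of (lam x M)) = ?n"
    using judgement_context[OF judgement.lam[OF assms(1)]] by simp
  have t: "braid_tensor ?n 1 s \<one>\<^bsub>braid_group 1\<^esub> = braid_class (?n + 1) w"
    using braid_tensor_class[OF w(1), of "[]" 1] by (simp add: w(2) braid_group_one)
  have c: "braid_class (?n + 1) w \<in> carrier (braid_group (length (\<Gamma> @ [x])))"
    using wb by (auto simp: braid_group_carrier)
  have B: "sem G (Braid (braid_class (?n + 1) w) M) =
      {(u, b). u \<in> xpower D (?n + 1) \<and> (word_step G D w u, b) \<in> sem G M}"
    using sem_braid_class[of w M] wb unfolding M(2) by simp
  have step: "word_step G D w (u @ [a]) = word_step G D w u @ [a]" if "u \<in> xpower D ?n" for u a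
    using word_step_props(5)[OF G D, of w u] that w(1) by (auto simp: xpower_def)
  have "sem G (lam x (Braid (braid_tensor ?n 1 s \<one>\<^bsub>braid_group 1\<^esub>) M)) =
      {(u, tree_phi G b a) | u a b. u @ [a] \<in> xpower D (?n + 1) \<and> (word_step G D w (u @ [a]), b) \<in> sem G M}"
    unfolding t sem_lam[OF judgement.braid[OF assms(1) c]] B by blast
  also have "\<dots> = {(u, tree_phi G b a) | u a b. u \<in> xpower D ?n \<and> (word_step G D w u @ [a], b) \<in> sem G M}"
  proof -
    have "u @ [a] \<in> xpower D (?n + 1) \<and> (word_step G D w (u @ [a]), b) \<in> sem G M \<longleftrightarrow>
        u \<in> xpower D ?n \<and> (word_step G D w u @ [a], b) \<in> sem G M" for u a b
    proof -
      have "u @ [a] \<in> xpower D (?n + 1) \<longleftrightarrow> u \<in> xpower D ?n \<and> a \<in> points D" by (auto simp: xpower_def)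
      \<comment> \<open>The added strand must carry a point of \<open>D\<close>; this is automatic,
        as the braid leaves it alone and \<open>sem G M\<close> relates only tuples of
        points.\<close>
      moreover have "a \<in> points D" if "(v @ [a], b) \<in> sem G M" for v
        using sem_typed[OF M(1) that] by (auto simp: xpower_def)
      ultimately show ?thesis using step by metis
    qed
    then show ?thesis by simp
  qed
  also have "\<dots> = sem G (Braid s (lam x M))"
    using sem_braid_class[of w "lam x M"] w(1) unfolding lM w(2) sem_lam[OF assms(1)]
    by (auto simp del: sem.simps)
  finally show ?thesis by simp
qed

text \<open>As \<open>sem\<close> takes no context, symmetry and transitivity are immediate and no
  subject reduction is called for.\<close>

lemma sem_beta_eta: "M =\<^sub>\<beta>\<^sub>\<eta> N \<Longrightarrow> sem G M = sem G N"
proof (induction rule: beta_eta.induct)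
  case (cong_lam M N \<Gamma> x)
  then show ?case by (simp add: sem_lam)
next
  case (cong_braid M N \<Gamma> s)
  \<comment> \<open>The braid is interpreted on as many strands as the body has variables; the
    common context makes these numbers equal.\<close>
  have "length (context_of M) = length \<Gamma>" "length (context_of N) = length \<Gamma>"
    using cong_braid.hyps(2,3)[THEN judgement_context, THEN arg_cong[of _ _ length]] by simp_all
  then show ?case using cong_braid.IH by simp
next
  case (beta \<Gamma> x M \<Delta> N)
  show ?case using sem_App_lam[OF beta(1,2)] .
next
  case (eta \<Gamma> M x)
  show ?case using sem_eta[OF eta] .
next
  case (braid_one \<Gamma> M)
  then have "length \<Gamma> = length (context_of M)" by (simp add: judgement_context)
  then show ?case
    \<comment> \<open>The empty word restricts \<open>sem G M\<close> to tuples of points, where it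
      already lives by \<open>sem_subset\<close>.\<close>
    using sem_braid_class[of "[]" M] sem_subset[OF judgement_well_scoped[OF braid_one]]
    by (auto simp: braid_group_one word_step_simps[OF G D] simp del: sem.simps)
next
  case (braid_mult \<Gamma> M s s')
  then show ?case using sem_braid_mult[of s M s'] by (simp add: judgement_context del: sem.simps)
next
  case (braid_app \<Gamma> M \<Delta> N s s')
  then show ?case using sem_braid_App[of M N s s']
    by (simp add: judgement_context judgement_well_scoped del: sem.simps)
next
  case (braid_lam \<Gamma> x M s)
  show ?case using sem_braid_lam[OF braid_lam] .
qed auto

end

theorem mainTheorem4:
  fixes G :: "('g, 'm) monoid_scheme"
  assumes "group G"
  shows
    "(crossed_gset G (tree_xset G) \<and>
      bij_betw (\<lambda>(f0, f1). tree_phi G f0 f1) (tree_set G \<times> tree_set G) (tree_set G) \<and>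
      xrel_iso G (xtensor G (tree_xset G) (xdual G (tree_xset G))) (tree_xset G)
        {((f0, f1), tree_phi G f0 f1) | f0 f1. f0 \<in> tree_set G \<and> f1 \<in> tree_set G}) \<and>
     xrel_iso G (tree_xset G) (xdual G (tree_xset G))
       {(f, tree_star G f) | f. f \<in> tree_set G} \<and>
     ((\<forall>\<Gamma> M. \<Gamma> \<turnstile> M \<longrightarrow>
         (\<exists>!R. denotes G \<Gamma> M R) \<and>
         interp G \<Gamma> M \<subseteq> xpower (tree_xset G) (length \<Gamma>) \<times> tree_set G) \<and>
      (\<forall>\<Gamma> M N. \<Gamma> \<turnstile> M \<longrightarrow> \<Gamma> \<turnstile> N \<longrightarrow> M =\<^sub>\<beta>\<^sub>\<eta> N \<longrightarrow> interp G \<Gamma> M = interp G \<Gamma> N))"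
proof (intro conjI allI impI)
  fix \<Gamma> M assume M: "\<Gamma> \<turnstile> M"
  show "\<exists>!R. denotes G \<Gamma> M R" by (rule denotes_unique[OF M])
  show "interp G \<Gamma> M \<subseteq> xpower (tree_xset G) (length \<Gamma>) \<times> tree_set G"
    using sem_subset[OF assms judgement_well_scoped[OF M]]
    by (simp add: interp_sem[OF M] judgement_context[OF M])
  fix N assume "\<Gamma> \<turnstile> N" "M =\<^sub>\<beta>\<^sub>\<eta> N"
  then show "interp G \<Gamma> M = interp G \<Gamma> N"
    using sem_beta_eta[OF assms] by (simp add: interp_sem[OF M] interp_sem)
qed (rule crossed_tree_xset[OF assms] bij_tree_phi[OF assms] iso_tree_phi[OF assms] iso_tree_star[OF assms])+

end
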